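(* Let $\mathcal{S}\subset\mathbb{N}^3$ be a simplicial semigroup generated by $\mathcal{A}=\{\mathbf{a}_1,\ldots,\mathbf{a}_n\}$ as in the context, so that $\Bbbk[\mathcal{S}]$ is a simplicial semigroup ring of Krull dimension $3$. Then the multisets $\mathcal{S}_0,\mathcal{S}_1,\mathcal{S}_2$ of shifts in the minimal $\mathcal{S}$-graded free resolution of $\Bbbk[\mathcal{S}]$ as a module over $A=\Bbbk[x_{n-2},x_{n-1},x_n]$ are $$\mathcal{S}_0=\mathrm{AP}_{\mathcal{S}},\qquad \mathcal{S}_1=E_{\mathcal{S}}^{3,1}\cup E_{\mathcal{S}}^{2,0}\cup E_{\mathcal{S}}^{3,0}\cup E_{\mathcal{S}}^{3,0},\qquad \mathcal{S}_2=E_{\mathcal{S}}^{3,3},$$ where the union is a union of multisets (so each element of $E_{\mathcal{S}}^{3,0}$ occurs in $\mathcal{S}_1$ with multiplicity $2$, and each element of $E_{\mathcal{S}}^{3,1}\cup E_{\mathcal{S}}^{2,0}$ with multiplicity $1$).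
   Context: Let $\Bbbk$ be an arbitrary field and $\mathcal{A}=\{\mathbf{a}_1,\ldots,\mathbf{a}_n\}\subset\mathbb{N}^3$ a finite set of nonzero vectors; $\mathcal{S}=\{\sum_i\lambda_i\mathbf{a}_i\mid\lambda_i\in\mathbb{N}\}$ is the affine monoid it spans. $\mathcal{S}$ is assumed simplicial, with extremal rays along the axes: $\mathbf{a}_{n-3+i}=\omega_{n-3+i}\,\boldsymbol\epsilon_i$ for $i=1,2,3$, where $\{\boldsymbol\epsilon_1,\boldsymbol\epsilon_2,\boldsymbol\epsilon_3\}$ is the canonical basis of $\mathbb{N}^3$ and $\omega_{n-2},\omega_{n-1},\omega_n\in\mathbb{Z}^+$. Put $\mathbf{e}_i=\mathbf{a}_{n-3+i}$, $i=1,2,3$. $\Bbbk[\mathcal{S}]=\Bbbk[\mathbf{t}^{\mathbf{s}}\mid\mathbf{s}\in\mathcal{S}]$ is the semigroup algebra, $\mathcal{S}$-graded, isomorphic to $\Bbbk[x_1,\ldots,x_n]/I_{\mathcal{A}}$ via $x_i\mapsto\mathbf{t}^{\mathbf{a}_i}$, where $I_{\mathcal{A}}$ is the toric ideal (kernel of $x_i\mapsto\mathbf{t}^{\mathbf{a}_i}$) and $\deg_{\mathcal{S}}(x_i)=\mathbf{a}_i$. $A=\Bbbk[x_{n-2},x_{n-1},x_n]$ is a Noether normalization, so $\Bbbk[\mathcal{S}]$ is a finitely generated $\mathcal{S}$-graded $A$-module. Its minimal $\mathcal{S}$-graded free resolution as $A$-module (the short resolution) is written $$0\to\bigoplus_{\mathbf{s}\in\mathcal{S}_p}A(-\mathbf{s})\to\cdots\to\bigoplus_{\mathbf{s}\in\mathcal{S}_1}A(-\mathbf{s})\to\bigoplus_{\mathbf{s}\in\mathcal{S}_0}A(-\mathbf{s})\to\Bbbk[\mathcal{S}]\to0,$$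 with finite multisets $\mathcal{S}_i\subset\mathcal{S}$ (and $\mathcal{S}_i=\emptyset$ for $i>p$). Apery set: $\mathrm{AP}_{\mathcal{S}}=\{\mathbf{s}\in\mathcal{S}\mid\mathbf{s}-\mathbf{e}_i\notin\mathcal{S}\text{ for all }i=1,2,3\}$. Exceptional sets: - $E_{\mathcal{S}}^{3,1}$: all $\mathbf{s}\in\mathcal{S}$ with $\mathbf{s}-\mathbf{e}_j\in\mathcal{S}$ for all $j$ and such that, for some permutation $(i_1,i_2,i_3)$ of $(1,2,3)$, $\mathbf{s}-(\mathbf{e}_{i_1}+\mathbf{e}_{i_2})\in\mathcal{S}$, $\mathbf{s}-(\mathbf{e}_{i_1}+\mathbf{e}_{i_3})\notin\mathcal{S}$, $\mathbf{s}-(\mathbf{e}_{i_2}+\mathbf{e}_{i_3})\notin\mathcal{S}$. - $E_{\mathcal{S}}^{2,0}$: all $\mathbf{s}\in\mathcal{S}$ such that, for some permutation $(i_1,i_2,i_3)$ of $(1,2,3)$, $\mathbf{s}-\mathbf{e}_{i_1}\in\mathcal{S}$, $\mathbf{s}-\mathbf{e}_{i_2}\in\mathcal{S}$, $\mathbf{s}-\mathbf{e}_{i_3}\notin\mathcal{S}$ and $\mathbf{s}-(\mathbf{e}_{i_1}+\mathbf{e}_{i_2})\notin\mathcal{S}$. - $E_{\mathcal{S}}^{3,0}$: all $\mathbf{s}\in\mathcal{S}$ with $\mathbf{s}-\mathbf{e}_i\in\mathcal{S}$ for all $i$ and $\mathbf{s}-(\mathbf{e}_i+\mathbf{e}_j)\notin\mathcal{S}$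 for all $i\ne j$. - $E_{\mathcal{S}}^{3,3}$: all $\mathbf{s}\in\mathcal{S}$ with $\mathbf{s}-\mathbf{e}_i\in\mathcal{S}$ for all $i$, $\mathbf{s}-(\mathbf{e}_i+\mathbf{e}_j)\in\mathcal{S}$ for all $i\ne j$, and $\mathbf{s}-(\mathbf{e}_1+\mathbf{e}_2+\mathbf{e}_3)\notin\mathcal{S}$. *)

theory Defs
  imports
    "HOL-Analysis.Finite_Cartesian_Product"
    "HOL-Library.Poly_Mapping"
    "HOL-Library.Multiset"
begin

section \<open>The monoid and its exceptional sets\<close>

text \<open>
  Degrees live in the group of integer vectors of length 3, so that a difference such as
  \<open>s - e i\<close> is the honest difference (which may leave the nonnegative octant).
\<close>

definition affine_monoid :: "nat \<Rightarrow> (nat \<Rightarrow> int ^ 3) \<Rightarrow> (int ^ 3) set" where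
  "affine_monoid n a = {\<Sum>i = 1..n. int (l i) *s a i | l. True}"

text \<open>The last three generators, reindexed by the type \<open>3\<close> (in which \<open>3 = 0\<close>).\<close>

definition ray_gen :: "nat \<Rightarrow> (nat \<Rightarrow> int ^ 3) \<Rightarrow> 3 \<Rightarrow> int ^ 3" where
  "ray_gen n a i = (if i = 1 then a (n - 2) else if i = 2 then a (n - 1) else a n)"

definition apery :: "(int ^ 3) set \<Rightarrow> (3 \<Rightarrow> int ^ 3) \<Rightarrow> (int ^ 3) set" where
  "apery S e = {s \<in> S. \<forall>i. s - e i \<notin> S}"

definition exc31 :: "(int ^ 3) set \<Rightarrow> (3 \<Rightarrow> int ^ 3) \<Rightarrow> (int ^ 3) set" where
  "exc31 S e = {s \<in> S. (\<forall>j. s - e j \<in> S) \<and>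
     (\<exists>i1 i2 i3. distinct [i1, i2, i3] \<and> s - (e i1 + e i2) \<in> S \<and>
        s - (e i1 + e i3) \<notin> S \<and> s - (e i2 + e i3) \<notin> S)}"

definition exc20 :: "(int ^ 3) set \<Rightarrow> (3 \<Rightarrow> int ^ 3) \<Rightarrow> (int ^ 3) set" where
  "exc20 S e = {s \<in> S.
     \<exists>i1 i2 i3. distinct [i1, i2, i3] \<and> s - e i1 \<in> S \<and> s - e i2 \<in> S \<and>
        s - e i3 \<notin> S \<and> s - (e i1 + e i2) \<notin> S}"

definition exc30 :: "(int ^ 3) set \<Rightarrow> (3 \<Rightarrow> int ^ 3) \<Rightarrow> (int ^ 3) set" where
  "exc30 S e = {s \<in> S. (\<forall>i. s - e i \<in> S) \<and> (\<forall>i j. i \<noteq> j \<longrightarrow> s - (e i + e j) \<notin> S)}"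

definition exc33 :: "(int ^ 3) set \<Rightarrow> (3 \<Rightarrow> int ^ 3) \<Rightarrow> (int ^ 3) set" where
  "exc33 S e = {s \<in> S. (\<forall>i. s - e i \<in> S) \<and> (\<forall>i j. i \<noteq> j \<longrightarrow> s - (e i + e j) \<in> S) \<and>
     s - (e 1 + e 2 + e 3) \<notin> S}"


section \<open>The polynomial ring and the semigroup algebra\<close>

text \<open>
  The polynomial ring \<open>A\<close> in three variables: the coefficient of \<open>x\<^sup>u\<close> in \<open>f\<close> is \<open>lookup f u\<close>.
\<close>

type_synonym 'k poly3 = "(nat ^ 3) \<Rightarrow>\<^sub>0 'k"

text \<open>
  The ambient group algebra (Laurent polynomials in \<open>t\<^sub>1, t\<^sub>2, t\<^sub>3\<close>); the monomial \<open>t\<^sup>s\<close> is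
  \<open>Poly_Mapping.single s 1\<close>, and the product of \<open>Poly_Mapping\<close> is the convolution product.
\<close>

type_synonym 'k laurent3 = "(int ^ 3) \<Rightarrow>\<^sub>0 'k"

definition semigroup_algebra :: "(int ^ 3) set \<Rightarrow> 'k::zero laurent3 set" where
  "semigroup_algebra S = {g. Poly_Mapping.keys g \<subseteq> S}"

definition semigroup_algebra_comp :: "(int ^ 3) set \<Rightarrow> int ^ 3 \<Rightarrow> 'k::zero laurent3 set" where
  "semigroup_algebra_comp S c = {g \<in> semigroup_algebra S. Poly_Mapping.keys g \<subseteq> {c}}"

text \<open>The degree of the monomial \<open>x\<^sup>u\<close>, when the \<open>j\<close>-th variable has degree \<open>e j\<close>.\<close>

definition monom_degree :: "(3 \<Rightarrow> int ^ 3) \<Rightarrow> nat ^ 3 \<Rightarrow> int ^ 3" where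
  "monom_degree e u = (\<Sum>j\<in>UNIV. int (u $ j) *s e j)"

text \<open>
  The ring homomorphism from \<open>A\<close> that sends the \<open>j\<close>-th variable to \<open>t\<close> to the power \<open>e j\<close>; the
  semigroup algebra is an \<open>A\<close>-module through it.
\<close>

definition poly_to_laurent :: "(3 \<Rightarrow> int ^ 3) \<Rightarrow> 'k::comm_ring_1 poly3 \<Rightarrow> 'k laurent3" where
  "poly_to_laurent e f =
     (\<Sum>u\<in>Poly_Mapping.keys f. Poly_Mapping.single (monom_degree e u) (Poly_Mapping.lookup f u))"

definition alg_scale ::
    "(3 \<Rightarrow> int ^ 3) \<Rightarrow> 'k::comm_ring_1 poly3 \<Rightarrow> 'k laurent3 \<Rightarrow> 'k laurent3" where
  "alg_scale e f g = poly_to_laurent e f * g"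


section \<open>Graded free modules\<close>

text \<open>
  A list \<open>ss\<close> of shifts stands for the graded free module
  \<open>A(- ss ! 0) \<oplus> \<dots> \<oplus> A(- ss ! (length ss - 1))\<close>. Its elements are the vectors
  \<open>v\<close> with coordinates \<open>lookup v j\<close> in \<open>A\<close> for \<open>j < length ss\<close>.
\<close>

definition free_mod :: "(int ^ 3) list \<Rightarrow> (nat \<Rightarrow>\<^sub>0 'k::zero poly3) set" where
  "free_mod ss = {v. Poly_Mapping.keys v \<subseteq> {..<length ss}}"

definition free_scale ::
    "'k::comm_ring_1 poly3 \<Rightarrow> (nat \<Rightarrow>\<^sub>0 'k poly3) \<Rightarrow> (nat \<Rightarrow>\<^sub>0 'k poly3)" where
  "free_scale f v = Poly_Mapping.map ((*) f) v"

text \<open>The component of degree \<open>c\<close>: the \<open>j\<close>-th basis vector has degree \<open>ss ! j\<close>.\<close>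

definition free_comp ::
    "(3 \<Rightarrow> int ^ 3) \<Rightarrow> (int ^ 3) list \<Rightarrow> int ^ 3 \<Rightarrow> (nat \<Rightarrow>\<^sub>0 'k::zero poly3) set" where
  "free_comp e ss c = {v \<in> free_mod ss.
     \<forall>j < length ss. \<forall>u \<in> Poly_Mapping.keys (Poly_Mapping.lookup v j).
       monom_degree e u + ss ! j = c}"

text \<open>
  The submodule \<open>\<mm> F\<close> of a free module \<open>F\<close>, where \<open>\<mm>\<close> is the ideal of \<open>A\<close> generated by
  the three variables, i.e. the ideal of polynomials with zero constant term.
\<close>

definition irrelevant_mult :: "(int ^ 3) list \<Rightarrow> (nat \<Rightarrow>\<^sub>0 'k::zero poly3) set" where
  "irrelevant_mult ss = {v \<in> free_mod ss.
     \<forall>j < length ss. Poly_Mapping.lookup (Poly_Mapping.lookup v j) 0 = 0}"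


section \<open>Minimal graded free resolutions\<close>

text \<open>
  Homomorphisms of degree 0 between graded modules with carriers \<open>M\<close>, \<open>N\<close>, scalar
  multiplications \<open>scM\<close>, \<open>scN\<close> and homogeneous components \<open>Mc\<close>, \<open>Nc\<close>. Nothing is required of
  \<open>\<phi>\<close> outside \<open>M\<close>.
\<close>

definition graded_hom ::
    "('r \<Rightarrow> 'm \<Rightarrow> 'm) \<Rightarrow> ('r \<Rightarrow> 'n \<Rightarrow> 'n) \<Rightarrow> 'm::plus set \<Rightarrow> 'n::plus set \<Rightarrow>
     ('d \<Rightarrow> 'm set) \<Rightarrow> ('d \<Rightarrow> 'n set) \<Rightarrow> ('m \<Rightarrow> 'n) \<Rightarrow> bool" where
  "graded_hom scM scN M N Mc Nc \<phi> \<longleftrightarrow>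
     \<phi> ` M \<subseteq> N \<and>
     (\<forall>v\<in>M. \<forall>w\<in>M. \<phi> (v + w) = \<phi> v + \<phi> w) \<and>
     (\<forall>r. \<forall>v\<in>M. \<phi> (scM r v) = scN r (\<phi> v)) \<and>
     (\<forall>c. \<phi> ` Mc c \<subseteq> Nc c)"

text \<open>
  The complex \<open>0 \<rightarrow> F p \<rightarrow> \<dots> \<rightarrow> F 1 \<rightarrow> F 0 \<rightarrow> k[S] \<rightarrow> 0\<close> with \<open>F i\<close> the graded free module of
  shifts \<open>F i\<close>, differential \<open>d i\<close> from \<open>F (i + 1)\<close> to \<open>F i\<close>, and augmentation \<open>aug\<close>.
\<close>

definition graded_free_resolution ::
    "(int ^ 3) set \<Rightarrow> (3 \<Rightarrow> int ^ 3) \<Rightarrow> nat \<Rightarrow> (nat \<Rightarrow> (int ^ 3) list) \<Rightarrow>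
     (nat \<Rightarrow> (nat \<Rightarrow>\<^sub>0 'k::field poly3) \<Rightarrow> (nat \<Rightarrow>\<^sub>0 'k poly3)) \<Rightarrow>
     ((nat \<Rightarrow>\<^sub>0 'k poly3) \<Rightarrow> 'k laurent3) \<Rightarrow> bool" where
  "graded_free_resolution S e p F d aug \<longleftrightarrow>
     (\<forall>i. set (F i) \<subseteq> S) \<and>
     (\<forall>i > p. F i = []) \<and>
     graded_hom free_scale (alg_scale e) (free_mod (F 0)) (semigroup_algebra S)
       (free_comp e (F 0)) (semigroup_algebra_comp S) aug \<and>
     (\<forall>i. graded_hom free_scale free_scale (free_mod (F (Suc i))) (free_mod (F i))
       (free_comp e (F (Suc i))) (free_comp e (F i)) (d i)) \<and>
     aug ` free_mod (F 0) = semigroup_algebra S \<and>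
     {v \<in> free_mod (F 0). aug v = 0} = d 0 ` free_mod (F 1) \<and>
     (\<forall>i. {v \<in> free_mod (F (Suc i)). d i v = 0} = d (Suc i) ` free_mod (F (Suc (Suc i))))"

definition minimal_graded_free_resolution ::
    "(int ^ 3) set \<Rightarrow> (3 \<Rightarrow> int ^ 3) \<Rightarrow> nat \<Rightarrow> (nat \<Rightarrow> (int ^ 3) list) \<Rightarrow>
     (nat \<Rightarrow> (nat \<Rightarrow>\<^sub>0 'k::field poly3) \<Rightarrow> (nat \<Rightarrow>\<^sub>0 'k poly3)) \<Rightarrow>
     ((nat \<Rightarrow>\<^sub>0 'k poly3) \<Rightarrow> 'k laurent3) \<Rightarrow> bool" where
  "minimal_graded_free_resolution S e p F d aug \<longleftrightarrow>
     graded_free_resolution S e p F d aug \<and>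
     (\<forall>i. d i ` free_mod (F (Suc i)) \<subseteq> irrelevant_mult (F i))"

end

theory Submission
  imports Defs "HOL-Analysis.Cartesian_Space" "HOL-Library.Product_Plus"
begin

text \<open>
  The multiplicity of a degree \<open>s\<close> in the \<open>i\<close>-th step of a minimal resolution is the dimension of
  \<open>F i / \<mm> F i\<close> in degree \<open>s\<close>. Minimality identifies this quotient with the zeroth Koszul
  homology of the \<open>i\<close>-th syzygy module, and \<open>i\<close> connecting isomorphisms identify the latter with
  the \<open>i\<close>-th Koszul homology of the semigroup algebra. All graded pieces of the semigroup algebra
  have dimension at most one, so its Koszul homology in degree \<open>s\<close> is the reduced homology of the
  simplicial complex of those \<open>J \<subseteq> {1, 2, 3}\<close> with \<open>s - (\<Sum>j\<in>J. e j) \<in> S\<close>. The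
  sets \<open>apery\<close>, \<open>exc31\<close>, \<open>exc20\<close>, \<open>exc30\<close>, \<open>exc33\<close> list the complexes with nonzero homology;
  they are finite because their elements occur among the finitely many shifts.
\<close>

section \<open>Dimensions of quotients\<close>

text \<open>Everything happens in one degree \<open>s\<close>: there the Koszul complex is a complex
  of vector spaces, and homologies are compared by dimension alone, so no quotient module is ever
  formed. Minimality enters as the inclusion of the kernel K of each cover F -> N in the ideal
  multiple mF. It makes H_0(K) -> H_0(F) the zero map; since the Koszul complex of a free module is
  exact in the homological degrees 1 and 2 used here, the long exact sequence leaves H_1(N) = H_0(K)
  and H_2(N) = H_1(K). Koszul homology in position i is reduced homology in dimension i - 1. So
  \<open>F 0\<close> sees the complex whose only face is empty, \<open>F 1\<close> the disconnected
  complexes, with the number of components minus one as multiplicity, and \<open>F 2\<close> the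
  hollow triangle. Three isolated points have three components, which is why \<open>exc30\<close>
  counts twice. No such complex has torsion, so the characteristic of the field does not matter. The
  resolution is exact as a sequence of whole modules, and its maps are unconstrained outside their
  carriers. Homogeneous preimages must therefore be extracted by projections before one degree can
  be isolated.\<close>

definition basis_mod ::
    "('k::field \<Rightarrow> 'm \<Rightarrow> 'm::ab_group_add) \<Rightarrow> 'm set \<Rightarrow> 'm set \<Rightarrow> 'i set \<Rightarrow> ('i \<Rightarrow> 'm) \<Rightarrow> bool"
  where
  "basis_mod sc C B J b \<longleftrightarrow> finite J \<and> b ` J \<subseteq> C \<and>
     (\<forall>v\<in>C. \<exists>x. v - (\<Sum>j\<in>J. sc (x j) (b j)) \<in> B) \<and>
     (\<forall>x. (\<Sum>j\<in>J. sc (x j) (b j)) \<in> B \<longrightarrow> (\<forall>j\<in>J. x j = 0))"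

text \<open>The dimension of the quotient of \<open>C\<close> by \<open>B\<close>, witnessed by
  representatives in \<open>C\<close>. Index sets lie in \<open>nat\<close> because an index type
  cannot be quantified existentially.\<close>

definition has_qdim :: "('k::field \<Rightarrow> 'm \<Rightarrow> 'm::ab_group_add) \<Rightarrow> 'm set \<Rightarrow> 'm set \<Rightarrow> nat \<Rightarrow> bool" where
  "has_qdim sc C B r \<longleftrightarrow>
     (\<exists>(J :: nat set) b. basis_mod sc C B J b \<and> card J = r)"

text \<open>Gaussian elimination: a homogeneous system with more unknowns than equations has a
  nontrivial solution. Each induction step spends one equation on one pivot unknown.\<close>

lemma exists_nontrivial_relation:
  fixes c :: "'i \<Rightarrow> 'j \<Rightarrow> 'k::field"
  assumes "finite H" "finite J" "card H < card J"
  shows "\<exists>y. (\<exists>j\<in>J. y j \<noteq> 0) \<and> (\<forall>h\<in>H. (\<Sum>j\<in>J. y j * c j h) = 0)"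
  using assms
proof (induction H arbitrary: J c rule: finite_induct)
  case empty
  then obtain j where "j \<in> J" by fastforce
  then show ?case by (intro exI[of _ "\<lambda>_. 1"]) auto
next
  case (insert h H)
  show ?case
  proof (cases "\<forall>j\<in>J. c j h = 0")
    case True
    have "card H < card J" using insert.hyps insert.prems by simp
    with insert.IH[OF insert.prems(1), of c] True show ?thesis by auto
  next
    case False
    then obtain i where i: "i \<in> J" "c i h \<noteq> 0" by auto
    \<comment> \<open>The coefficients left after the equation \<open>h\<close> has been used to
      eliminate the unknown \<open>i\<close>.\<close>
    let ?c = "\<lambda>j h'. c j h' - c j h / c i h * c i h'"
    have "card H < card (J - {i})" using insert.hyps insert.prems i by simp
    with insert.IH[of "J - {i}" ?c] insert.prems obtain y
      where y: "\<exists>j\<in>J - {i}. y j \<noteq> 0" "\<forall>h'\<in>H. (\<Sum>j\<in>J - {i}. y j * ?c j h') = 0" by auto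
    \<comment> \<open>The value of the pivot unknown that solves the equation
      \<open>h\<close>.\<close>
    define t where "t = - (\<Sum>j\<in>J - {i}. y j * c j h) / c i h"
    define y' where "y' = y(i := t)"
    have split: "(\<Sum>j\<in>J. y' j * c j h') = t * c i h' + (\<Sum>j\<in>J - {i}. y j * c j h')" for h'
      using insert.prems(1) i(1) by (simp add: sum.remove y'_def)
    have "(\<Sum>j\<in>J. y' j * c j h') = 0" if "h' \<in> H" for h'
    proof -
      have "(\<Sum>j\<in>J - {i}. y j * ?c j h') =
          (\<Sum>j\<in>J - {i}. y j * c j h') - (\<Sum>j\<in>J - {i}. y j * c j h) / c i h * c i h'"
        by (simp add: right_diff_distrib sum_subtractf sum_distrib_right sum_divide_distrib mult.assoc)
      then show ?thesis using y(2) that by (simp add: split t_def)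
    qed
    moreover have "(\<Sum>j\<in>J. y' j * c j h) = 0" using i(2) by (simp add: split t_def)
    moreover have "\<exists>j\<in>J. y' j \<noteq> 0" using y(1) by (auto simp: y'_def)
    ultimately show ?thesis by blast
  qed
qed

context vector_space
begin

text \<open>Expand each \<open>b j\<close> in \<open>b'\<close> modulo \<open>B\<close>. If there
  were more \<open>b\<close> than \<open>b'\<close>, the coefficient rows would be dependent, and
  the same dependence would put a nontrivial combination of \<open>b\<close> into
  \<open>B\<close>.\<close>

lemma card_le_of_basis_mod:
  assumes B: "subspace B"
    and b: "basis_mod scale C B J b" and b': "basis_mod scale C B J' b'"
  shows "card J \<le> card J'"
proof (rule ccontr)
  assume "\<not> card J \<le> card J'"
  then have less: "card J' < card J" by simp
  have fin: "finite J" "finite J'" and bC: "\<forall>j\<in>J. b j \<in> C"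
    using b b' by (auto simp: basis_mod_def)
  have "\<forall>j\<in>J. \<exists>x. b j - (\<Sum>i\<in>J'. scale (x i) (b' i)) \<in> B"
    using b' bC by (auto simp: basis_mod_def)
  then obtain x where x: "\<forall>j\<in>J. b j - (\<Sum>i\<in>J'. scale (x j i) (b' i)) \<in> B"
    by metis
  obtain y where y: "\<exists>j\<in>J. y j \<noteq> 0" "\<forall>i\<in>J'. (\<Sum>j\<in>J. y j * x j i) = 0"
    using exists_nontrivial_relation[OF fin(2,1), of x] less by auto
  have "(\<Sum>j\<in>J. scale (y j) (\<Sum>i\<in>J'. scale (x j i) (b' i))) =
      (\<Sum>i\<in>J'. scale (\<Sum>j\<in>J. y j * x j i) (b' i))"
    by (simp add: scale_sum_right scale_sum_left sum.swap[of _ J' J])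
  also have "\<dots> = 0" using y(2) by simp
  finally have "(\<Sum>j\<in>J. scale (y j) (b j)) =
      (\<Sum>j\<in>J. scale (y j) (b j - (\<Sum>i\<in>J'. scale (x j i) (b' i))))"
    by (simp add: scale_right_diff_distrib sum_subtractf)
  also have "\<dots> \<in> B" using x by (intro subspace_sum subspace_scale B) auto
  finally show False using b y(1) by (auto simp: basis_mod_def)
qed

lemma has_qdim_unique:
  assumes "subspace B" "has_qdim scale C B r" "has_qdim scale C B r'"
  shows "r = r'"
  using assms card_le_of_basis_mod unfolding has_qdim_def by (metis le_antisym)

lemma has_qdim_0:
  assumes "C \<subseteq> B"
  shows "has_qdim scale C B 0"
  unfolding has_qdim_def basis_mod_def
  using assms by (intro exI[of _ "{}"] exI[of _ "\<lambda>_. 0"]) auto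

lemma has_qdim_1:
  assumes "b \<in> C" "\<And>v. v \<in> C \<Longrightarrow> \<exists>x. v - scale x b \<in> B" "\<And>x. scale x b \<in> B \<Longrightarrow> x = 0"
  shows "has_qdim scale C B 1"
  unfolding has_qdim_def basis_mod_def
proof (intro exI[of _ "{0}"] exI[of _ "\<lambda>_. b"] conjI ballI allI impI)
  fix v assume "v \<in> C"
  then obtain x where "v - scale x b \<in> B" using assms by blast
  then show "\<exists>x. v - (\<Sum>j\<in>{0::nat}. scale (x j) b) \<in> B" by (intro exI[of _ "\<lambda>_. x"]) simp
qed (use assms in auto)

lemma has_qdim_2:
  assumes "b \<in> C" "b' \<in> C" "\<And>v. v \<in> C \<Longrightarrow> \<exists>x y. v - (scale x b + scale y b') \<in> B"
    "\<And>x y. scale x b + scale y b' \<in> B \<Longrightarrow> x = 0 \<and> y = 0"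
  shows "has_qdim scale C B 2"
  unfolding has_qdim_def basis_mod_def
proof (intro exI[of _ "{0, 1}"] exI[of _ "\<lambda>j. if j = 0 then b else b'"] conjI ballI allI impI)
  fix v assume "v \<in> C"
  then obtain x y where "v - (scale x b + scale y b') \<in> B" using assms by blast
  then show "\<exists>x. v - (\<Sum>j\<in>{0, 1::nat}. scale (x j) (if j = 0 then b else b')) \<in> B"
    by (intro exI[of _ "\<lambda>j. if j = 0 then x else y"]) simp
next
  fix x :: "nat \<Rightarrow> 'a" and j :: nat
  assume "(\<Sum>j\<in>{0, 1::nat}. scale (x j) (if j = 0 then b else b')) \<in> B" "j \<in> {0, 1}"
  then show "x j = 0" using assms(4)[of "x 0" "x 1"] by auto
qed (use assms in auto)

end

text \<open>\<open>R\<close> is a linear relation inducing an isomorphism of quotients;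
  \<open>RB\<close> makes the induced map both well defined and injective. A relation replaces a
  function because a connecting homomorphism depends on the choice of a lift.\<close>

lemma has_qdim_transport:
  fixes sc :: "'k::field \<Rightarrow> 'm::ab_group_add \<Rightarrow> 'm" and sc' :: "'k \<Rightarrow> 'n::ab_group_add \<Rightarrow> 'n"
  assumes R0: "R 0 0"
    and Rdiff: "\<And>v w v' w'. R v v' \<Longrightarrow> R w w' \<Longrightarrow> R (v - w) (v' - w')"
    and Rsc: "\<And>k v v'. R v v' \<Longrightarrow> R (sc k v) (sc' k v')"
    and tot: "\<And>v. v \<in> C \<Longrightarrow> \<exists>v'\<in>C'. R v v'" and tot': "\<And>v'. v' \<in> C' \<Longrightarrow> \<exists>v\<in>C. R v v'"
    and RB: "\<And>v v'. R v v' \<Longrightarrow> v \<in> B \<longleftrightarrow> v' \<in> B'"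
    and "has_qdim sc C B r"
  shows "has_qdim sc' C' B' r"
proof -
  obtain J :: "nat set" and b where b: "basis_mod sc C B J b" "card J = r"
    using assms unfolding has_qdim_def by blast
  have "\<forall>j\<in>J. \<exists>v'. v' \<in> C' \<and> R (b j) v'"
    using b tot unfolding basis_mod_def by blast
  then obtain b' where b': "\<forall>j\<in>J. b' j \<in> C' \<and> R (b j) (b' j)" by metis
  have Radd: "R (v + w) (v' + w')" if "R v v'" "R w w'" for v w v' w'
    using Rdiff[OF that(1) Rdiff[OF R0 that(2)]] by simp
  have sum_in: "finite I \<Longrightarrow> I \<subseteq> J \<Longrightarrow> R (\<Sum>j\<in>I. sc (x j) (b j)) (\<Sum>j\<in>I. sc' (x j) (b' j))" for I x
    by (induction I rule: finite_induct) (use R0 Radd Rsc b' in auto)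
  have fin: "finite J" using b by (simp add: basis_mod_def)
  have sum: "R (\<Sum>j\<in>J. sc (x j) (b j)) (\<Sum>j\<in>J. sc' (x j) (b' j))" for x
    using sum_in[OF fin] by simp
  have "basis_mod sc' C' B' J b'"
    unfolding basis_mod_def
  proof (intro conjI ballI allI impI)
    fix v' assume "v' \<in> C'"
    then obtain v where v: "v \<in> C" "R v v'" using tot' by blast
    then obtain x where "v - (\<Sum>j\<in>J. sc (x j) (b j)) \<in> B" using b unfolding basis_mod_def by blast
    then show "\<exists>x. v' - (\<Sum>j\<in>J. sc' (x j) (b' j)) \<in> B'"
      using RB[OF Rdiff[OF v(2) sum]] by blast
  next
    fix x j assume "(\<Sum>j\<in>J. sc' (x j) (b' j)) \<in> B'" "j \<in> J"
    then show "x j = 0" using RB[OF sum] b unfolding basis_mod_def by blast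
  qed (use fin b' in auto)
  then show ?thesis using b(2) unfolding has_qdim_def by blast
qed

section \<open>Complexes and the connecting isomorphism\<close>

text \<open>Subtraction is primitive: together with \<open>0\<close> in the carrier it yields sums
  and negatives without any axioms on \<open>sc\<close>.\<close>

definition lin_on ::
    "('k \<Rightarrow> 'm \<Rightarrow> 'm) \<Rightarrow> ('k \<Rightarrow> 'n \<Rightarrow> 'n) \<Rightarrow> 'm::ab_group_add set \<Rightarrow> ('m \<Rightarrow> 'n::ab_group_add) \<Rightarrow> bool"
  where
  "lin_on sc sc' A f \<longleftrightarrow> 0 \<in> A \<and>
     (\<forall>v\<in>A. \<forall>w\<in>A. v - w \<in> A \<and> f (v - w) = f v - f w) \<and>
     (\<forall>k. \<forall>v\<in>A. sc k v \<in> A \<and> f (sc k v) = sc' k (f v))"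

lemma lin_onD:
  assumes "lin_on sc sc' A f"
  shows lin_on_0_mem: "0 \<in> A" and lin_on_0: "f 0 = 0"
    and lin_on_diff_mem: "v \<in> A \<Longrightarrow> w \<in> A \<Longrightarrow> v - w \<in> A"
    and lin_on_add_mem: "v \<in> A \<Longrightarrow> w \<in> A \<Longrightarrow> v + w \<in> A"
    and lin_on_diff: "v \<in> A \<Longrightarrow> w \<in> A \<Longrightarrow> f (v - w) = f v - f w"
    and lin_on_add: "v \<in> A \<Longrightarrow> w \<in> A \<Longrightarrow> f (v + w) = f v + f w"
    and lin_on_sc_mem: "v \<in> A \<Longrightarrow> sc k v \<in> A"
    and lin_on_sc: "v \<in> A \<Longrightarrow> f (sc k v) = sc' k (f v)"
proof -
  show z: "0 \<in> A"
    and d: "v \<in> A \<Longrightarrow> w \<in> A \<Longrightarrow> v - w \<in> A" "v \<in> A \<Longrightarrow> w \<in> A \<Longrightarrow> f (v - w) = f v - f w"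
    and "v \<in> A \<Longrightarrow> sc k v \<in> A" "v \<in> A \<Longrightarrow> f (sc k v) = sc' k (f v)" for v w
    using assms by (auto simp: lin_on_def)
  show f0: "f 0 = 0" using d(2)[of 0 0] z by simp
  show "v \<in> A \<Longrightarrow> w \<in> A \<Longrightarrow> v + w \<in> A" using d(1)[of v "0 - w"] d(1)[of 0 w] z by simp
  show "v \<in> A \<Longrightarrow> w \<in> A \<Longrightarrow> f (v + w) = f v + f w"
    using d(1)[of 0 w] d(2)[of v "0 - w"] d(2)[of 0 w] z f0 by simp
qed

text \<open>A surjection whose kernel already consists of boundaries induces an isomorphism of
  cokernels.\<close>

lemma has_qdim_coker:
  fixes sc :: "'k::field \<Rightarrow> 'm::ab_group_add \<Rightarrow> 'm"
    and sc' :: "'k \<Rightarrow> 'n::ab_group_add \<Rightarrow> 'n"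
  assumes \<pi>: "lin_on sc sc' F0 \<pi>0" "\<pi>0 ` F0 = N0" "\<pi>1 ` F1 = N1"
    and \<delta>: "lin_on sc1 sc F1 \<delta>" "\<delta> ` F1 \<subseteq> F0"
    and comm: "\<And>f. f \<in> F1 \<Longrightarrow> \<pi>0 (\<delta> f) = \<delta>' (\<pi>1 f)"
    and ker: "\<And>v. v \<in> F0 \<Longrightarrow> \<pi>0 v = 0 \<Longrightarrow> v \<in> \<delta> ` F1"
    and q: "has_qdim sc F0 (\<delta> ` F1) r"
  shows "has_qdim sc' N0 (\<delta>' ` N1) r"
proof (rule has_qdim_transport[OF _ _ _ _ _ _ q, where R = "\<lambda>v w. v \<in> F0 \<and> w = \<pi>0 v"])
  fix v w assume vw: "v \<in> F0 \<and> w = \<pi>0 v"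
  show "v \<in> \<delta> ` F1 \<longleftrightarrow> w \<in> \<delta>' ` N1"
  proof
    assume "w \<in> \<delta>' ` N1"
    then obtain f where f: "f \<in> F1" "w = \<pi>0 (\<delta> f)" using comm \<pi>(3) by auto
    then have "v - \<delta> f \<in> \<delta> ` F1"
      using vw \<delta>(2) by (intro ker) (auto simp: lin_onD[OF \<pi>(1)])
    then obtain g where "g \<in> F1" "v - \<delta> f = \<delta> g" by auto
    then have "v = \<delta> (f + g)" "f + g \<in> F1"
      using f(1) by (auto simp: lin_onD[OF \<delta>(1)] algebra_simps)
    then show "v \<in> \<delta> ` F1" by blast
  qed (use vw comm \<pi>(3) in auto)
qed (use \<pi>(2) in \<open>auto simp: lin_onD[OF \<pi>(1)]\<close>)

text \<open>
  The connecting homomorphism: for a surjection of complexes \<open>\<pi>\<close> with kernel \<open>K\<close>, where the source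
  complex \<open>F2 \<rightarrow> F1 \<rightarrow> F0\<close> is exact at \<open>F1\<close>, the cycles of the target at \<open>N1\<close> modulo boundaries
  correspond to the part of \<open>K0\<close> that dies in the homology of \<open>F\<close>, modulo the image of \<open>K1\<close>.
\<close>

lemma has_qdim_connecting:
  fixes sc0 :: "'k::field \<Rightarrow> 'm0::ab_group_add \<Rightarrow> 'm0"
    and sc1 :: "'k \<Rightarrow> 'm1::ab_group_add \<Rightarrow> 'm1"
    and sc1' :: "'k \<Rightarrow> 'n1::ab_group_add \<Rightarrow> 'n1"
  assumes \<delta>1: "lin_on sc1 sc0 F1 \<delta>1" "\<delta>1 ` F1 \<subseteq> F0" and \<delta>2: "\<delta>2 ` F2 \<subseteq> F1"
    and \<pi>1: "lin_on sc1 sc1' F1 \<pi>1" "\<pi>1 ` F1 = N1" and \<pi>0: "lin_on sc0 sc0' F0 \<pi>0"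
    and \<pi>2: "\<pi>2 ` F2 = N2"
    and complex: "\<And>p. p \<in> F2 \<Longrightarrow> \<delta>1 (\<delta>2 p) = 0"
    and exact: "\<And>f. f \<in> F1 \<Longrightarrow> \<delta>1 f = 0 \<Longrightarrow> f \<in> \<delta>2 ` F2"
    and comm1: "\<And>f. f \<in> F1 \<Longrightarrow> \<pi>0 (\<delta>1 f) = \<delta>1' (\<pi>1 f)"
    and comm2: "\<And>p. p \<in> F2 \<Longrightarrow> \<pi>1 (\<delta>2 p) = \<delta>2' (\<pi>2 p)"
    and q: "has_qdim sc0 {z \<in> \<delta>1 ` F1. \<pi>0 z = 0} (\<delta>1 ` {f \<in> F1. \<pi>1 f = 0}) r"
    and sc0': "\<And>k. sc0' k 0 = 0"
  shows "has_qdim sc1' {m \<in> N1. \<delta>1' m = 0} (\<delta>2' ` N2) r"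
proof (rule has_qdim_transport[OF _ _ _ _ _ _ q,
      where R = "\<lambda>z m. \<exists>f\<in>F1. z = \<delta>1 f \<and> m = \<pi>1 f \<and> \<pi>0 z = 0"])
  note l1 = lin_onD[OF \<delta>1(1)] and lp1 = lin_onD[OF \<pi>1(1)] and lp0 = lin_onD[OF \<pi>0]
  have mem: "\<delta>1 f \<in> F0" if "f \<in> F1" for f using that \<delta>1 by auto
  show "\<exists>f\<in>F1. (0 = \<delta>1 f \<and> 0 = \<pi>1 f \<and> \<pi>0 0 = 0)"
    by (intro bexI[of _ 0]) (simp_all add: l1 lp1(2) lp0(2))
  show "\<exists>f\<in>F1. v - w = \<delta>1 f \<and> v' - w' = \<pi>1 f \<and> \<pi>0 (v - w) = 0"
    if v: "\<exists>f\<in>F1. v = \<delta>1 f \<and> v' = \<pi>1 f \<and> \<pi>0 v = 0"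
      and w: "\<exists>f\<in>F1. w = \<delta>1 f \<and> w' = \<pi>1 f \<and> \<pi>0 w = 0" for v w v' w'
  proof -
    obtain f g where f: "f \<in> F1" "v = \<delta>1 f" "v' = \<pi>1 f" "\<pi>0 v = 0"
      and g: "g \<in> F1" "w = \<delta>1 g" "w' = \<pi>1 g" "\<pi>0 w = 0" using v w by blast
    have "\<pi>0 (v - w) = 0" using lp0(5)[OF mem[OF f(1)] mem[OF g(1)]] f g by simp
    then show ?thesis using f g by (intro bexI[of _ "f - g"]) (simp_all add: l1 lp1(5))
  qed
  show "\<exists>f\<in>F1. sc0 k v = \<delta>1 f \<and> sc1' k v' = \<pi>1 f \<and> \<pi>0 (sc0 k v) = 0"
    if v: "\<exists>f\<in>F1. v = \<delta>1 f \<and> v' = \<pi>1 f \<and> \<pi>0 v = 0" for k v v'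
  proof -
    obtain f where f: "f \<in> F1" "v = \<delta>1 f" "v' = \<pi>1 f" "\<pi>0 v = 0" using v by blast
    have "\<pi>0 (sc0 k v) = 0" using lp0(8)[OF mem[OF f(1)]] f sc0' by simp
    then show ?thesis using f by (intro bexI[of _ "sc1 k f"]) (simp_all add: l1 lp1(8))
  qed
  show "\<exists>m\<in>{m \<in> N1. \<delta>1' m = 0}. \<exists>f\<in>F1. z = \<delta>1 f \<and> m = \<pi>1 f \<and> \<pi>0 z = 0"
    if "z \<in> {z \<in> \<delta>1 ` F1. \<pi>0 z = 0}" for z
    using that \<pi>1(2) comm1 by fastforce
  show "\<exists>z\<in>{z \<in> \<delta>1 ` F1. \<pi>0 z = 0}. \<exists>f\<in>F1. z = \<delta>1 f \<and> m = \<pi>1 f \<and> \<pi>0 z = 0"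
    if "m \<in> {m \<in> N1. \<delta>1' m = 0}" for m
    using that \<pi>1(2) comm1 by fastforce
  fix z m assume "\<exists>f\<in>F1. z = \<delta>1 f \<and> m = \<pi>1 f \<and> \<pi>0 z = 0"
  then obtain f where f: "f \<in> F1" "z = \<delta>1 f" "m = \<pi>1 f" "\<pi>0 z = 0" by blast
  show "z \<in> \<delta>1 ` {f \<in> F1. \<pi>1 f = 0} \<longleftrightarrow> m \<in> \<delta>2' ` N2"
  proof
    assume "z \<in> \<delta>1 ` {f \<in> F1. \<pi>1 f = 0}"
    then obtain g where g: "g \<in> F1" "\<pi>1 g = 0" "z = \<delta>1 g" by auto
    have "\<delta>1 (f - g) = 0" "f - g \<in> F1" "\<pi>1 (f - g) = m"
      using f g by (simp_all add: l1 lp1(5))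
    then obtain p where "p \<in> F2" "f - g = \<delta>2 p" using exact by blast
    then have "m = \<delta>2' (\<pi>2 p)" "\<pi>2 p \<in> N2" using \<open>\<pi>1 (f - g) = m\<close> comm2 \<pi>2 by auto
    then show "m \<in> \<delta>2' ` N2" by blast
  next
    assume "m \<in> \<delta>2' ` N2"
    then obtain p where p: "p \<in> F2" "m = \<pi>1 (\<delta>2 p)" using \<pi>2 comm2 by auto
    have d: "\<delta>2 p \<in> F1" using p \<delta>2 by auto
    have "z = \<delta>1 (f - \<delta>2 p)" "f - \<delta>2 p \<in> F1" "\<pi>1 (f - \<delta>2 p) = 0"
      using f p d complex by (simp_all add: l1 lp1(5))
    then show "z \<in> \<delta>1 ` {f \<in> F1. \<pi>1 f = 0}" by blast
  qed
qed

section \<open>Koszul complexes of multigraded modules\<close>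

definition sc3 :: "('k \<Rightarrow> 'm \<Rightarrow> 'm) \<Rightarrow> 'k \<Rightarrow> 'm \<times> 'm \<times> 'm \<Rightarrow> 'm \<times> 'm \<times> 'm" where
  "sc3 sc k = map_prod (sc k) (map_prod (sc k) (sc k))"

definition kos1 :: "(3 \<Rightarrow> 'd) \<Rightarrow> ('d \<Rightarrow> 'm set) \<Rightarrow> 'd::ab_group_add \<Rightarrow> ('m \<times> 'm \<times> 'm) set" where
  "kos1 e gr s = gr (s - e 1) \<times> gr (s - e 2) \<times> gr (s - e 3)"

text \<open>Component \<open>i\<close> belongs to the edge opposite to vertex
  \<open>i\<close>.\<close>

definition kos2 :: "(3 \<Rightarrow> 'd) \<Rightarrow> ('d \<Rightarrow> 'm set) \<Rightarrow> 'd::ab_group_add \<Rightarrow> ('m \<times> 'm \<times> 'm) set" where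
  "kos2 e gr s = gr (s - (e 2 + e 3)) \<times> gr (s - (e 1 + e 3)) \<times> gr (s - (e 1 + e 2))"

definition kos3 :: "(3 \<Rightarrow> 'd) \<Rightarrow> ('d \<Rightarrow> 'm set) \<Rightarrow> 'd::ab_group_add \<Rightarrow> 'm set" where
  "kos3 e gr s = gr (s - (e 1 + e 2 + e 3))"

definition bd1 :: "(3 \<Rightarrow> 'm \<Rightarrow> 'm) \<Rightarrow> 'm \<times> 'm \<times> 'm \<Rightarrow> 'm::ab_group_add" where
  "bd1 X = (\<lambda>(a, b, c). X 1 a + X 2 b + X 3 c)"

text \<open>With \<open>X\<close> read as a vector of operators, \<open>bd1\<close> is the scalar
  product with \<open>X\<close>, \<open>bd2\<close> the cross product and \<open>bd3\<close> the
  multiple of \<open>X\<close>. This fixes the Koszul signs.\<close>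

definition bd2 :: "(3 \<Rightarrow> 'm \<Rightarrow> 'm) \<Rightarrow> 'm \<times> 'm \<times> 'm \<Rightarrow> 'm \<times> 'm \<times> 'm::ab_group_add" where
  "bd2 X = (\<lambda>(a, b, c). (X 2 c - X 3 b, X 3 a - X 1 c, X 1 b - X 2 a))"

definition bd3 :: "(3 \<Rightarrow> 'm \<Rightarrow> 'm) \<Rightarrow> 'm \<Rightarrow> 'm \<times> 'm \<times> 'm" where
  "bd3 X u = (X 1 u, X 2 u, X 3 u)"

text \<open>Of the ring \<open>A\<close> only the action of the three variables is recorded, so that
  free modules, syzygies and the semigroup algebra are all instances. The premise
  \<open>c + e i = c'\<close> leaves the matching of degrees to arithmetic.\<close>

locale koszul_module = vector_space sc
  for sc :: "'k::field \<Rightarrow> 'm::ab_group_add \<Rightarrow> 'm" +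
  fixes e :: "3 \<Rightarrow> 'd::ab_group_add" and X :: "3 \<Rightarrow> 'm \<Rightarrow> 'm" and gr :: "'d \<Rightarrow> 'm set"
  assumes subspace_comp: "subspace (gr c)"
    and X_diff: "X i (v - w) = X i v - X i w"
    and X_sc: "X i (sc k v) = sc k (X i v)"
    and X_comm: "X i (X j v) = X j (X i v)"
    and X_comp: "v \<in> gr c \<Longrightarrow> c + e i = c' \<Longrightarrow> X i v \<in> gr c'"
begin

lemma X_0: "X i 0 = 0"
  using X_diff[of i 0 0] by simp

lemma X_uminus: "X i (- v) = - X i v"
  using X_diff[of i 0 v] by (simp add: X_0)

lemma X_add: "X i (v + w) = X i v + X i w"
  using X_diff[of i v "- w"] by (simp add: X_uminus)

lemmas X_simps = X_0 X_uminus X_add X_diff X_sc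

lemma comp_mem:
  "0 \<in> gr c" "v \<in> gr c \<Longrightarrow> - v \<in> gr c" "v \<in> gr c \<Longrightarrow> sc k v \<in> gr c"
  "v \<in> gr c \<Longrightarrow> w \<in> gr c \<Longrightarrow> v + w \<in> gr c" "v \<in> gr c \<Longrightarrow> w \<in> gr c \<Longrightarrow> v - w \<in> gr c"
  using subspace_comp[of c]
  by (simp_all add: subspace_0 subspace_neg subspace_scale subspace_add subspace_diff)

lemma lin_on_bd:
  shows lin_on_bd1: "lin_on (sc3 sc) sc (kos1 e gr s) (bd1 X)"
    and lin_on_bd2: "lin_on (sc3 sc) (sc3 sc) (kos2 e gr s) (bd2 X)"
    and lin_on_bd3: "lin_on sc (sc3 sc) (kos3 e gr s) (bd3 X)"
  by (auto simp: lin_on_def kos1_def kos2_def kos3_def sc3_def bd1_def bd2_def bd3_def zero_prod_def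
      minus_prod_def comp_mem X_simps scale_right_distrib scale_right_diff_distrib)

lemma bd_mem:
  shows bd1_mem: "bd1 X ` kos1 e gr s \<subseteq> gr s"
    and bd2_mem: "bd2 X ` kos2 e gr s \<subseteq> kos1 e gr s"
    and bd3_mem: "bd3 X ` kos3 e gr s \<subseteq> kos2 e gr s"
  by (auto simp: kos1_def kos2_def kos3_def bd1_def bd2_def bd3_def
      intro!: comp_mem X_comp)

lemma bd1_bd2: "bd1 X (bd2 X p) = 0"
  by (cases p) (simp add: bd1_def bd2_def X_simps X_comm[of 2 1] X_comm[of 3 1] X_comm[of 3 2])

lemma bd2_bd3: "bd2 X (bd3 X u) = 0"
  by (simp add: bd2_def bd3_def zero_prod_def X_comm[of 2 1] X_comm[of 3 1] X_comm[of 3 2])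

end

text \<open>
  The left inverses \<open>D i\<close> of multiplication by the variables encode that these form a regular
  sequence; this is all that exactness of the Koszul complex needs.
\<close>

locale free_koszul_module = koszul_module sc e X gr
  for sc :: "'k::field \<Rightarrow> 'm::ab_group_add \<Rightarrow> 'm" and e :: "3 \<Rightarrow> 'd::ab_group_add" and X gr +
  fixes D :: "3 \<Rightarrow> 'm \<Rightarrow> 'm"
  assumes D_diff: "D i (v - w) = D i v - D i w"
    and D_X: "D i (X i v) = v"
    and D_X_comm: "i \<noteq> j \<Longrightarrow> D i (X j v) = X j (D i v)"
    and D_comp: "v \<in> gr c \<Longrightarrow> c = c' + e i \<Longrightarrow> D i v \<in> gr c'"
begin

lemma D_0: "D i 0 = 0"
  using D_diff[of i 0 0] by simp

lemma D_uminus: "D i (- v) = - D i v"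
  using D_diff[of i 0 v] by (simp add: D_0)

lemma D_add: "D i (v + w) = D i v + D i w"
  using D_diff[of i v "- w"] by (simp add: D_uminus)

lemmas D_simps = D_0 D_uminus D_add D_diff D_X

text \<open>Dividing the relation by the third variable expresses \<open>c\<close> through
  \<open>D 3 a\<close> and \<open>D 3 b\<close>. Subtracting the corresponding boundary leaves a
  relation between \<open>a'\<close> and \<open>b'\<close> in the first two variables only, which
  the same trick solves.\<close>

lemma exact_bd1:
  assumes "f \<in> kos1 e gr s" "bd1 X f = 0"
  shows "f \<in> bd2 X ` kos2 e gr s"
proof -
  obtain a b c where f: "f = (a, b, c)" by (cases f)
  have mem: "a \<in> gr (s - e 1)" "b \<in> gr (s - e 2)" "c \<in> gr (s - e 3)"
    and eq: "X 1 a + X 2 b + X 3 c = 0"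
    using assms by (auto simp: f kos1_def bd1_def)
  have "D 3 (X 1 a + X 2 b + X 3 c) = 0" by (simp add: eq D_0)
  then have c: "c = - X 1 (D 3 a) - X 2 (D 3 b)"
    by (auto simp: D_simps D_X_comm dest!: minus_unique)
  define a' where "a' = a - X 3 (D 3 a)"
  define b' where "b' = b - X 3 (D 3 b)"
  have eq': "X 1 a' + X 2 b' = 0"
    using eq by (simp add: a'_def b'_def c X_simps X_comm[of 3 1] X_comm[of 3 2] algebra_simps)
  \<comment> \<open>Dividing by variable 1 and by variable 2 shows that \<open>a'\<close> and
    \<open>b'\<close> are multiples of the opposite variables; comparing the two quotients gives one
    common factor.\<close>
  have "D 1 (X 1 a' + X 2 b') = 0" "D 2 (X 1 a' + X 2 b') = 0" by (simp_all add: eq' D_0)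
  then have a': "a' = - X 2 (D 1 b')" and b2: "b' = - X 1 (D 2 a')"
    by (simp_all add: D_simps D_X_comm add_eq_0_iff add_eq_0_iff2)
  have "D 2 a' = - D 1 b'" by (subst a') (simp add: D_simps)
  then have b': "b' = X 1 (D 1 b')" using b2 by (metis X_uminus minus_minus)
  have "f = bd2 X (D 3 b, - D 3 a, - D 1 b')"
    using a' b' by (simp add: f bd2_def X_simps c a'_def b'_def algebra_simps)
  moreover have "D 3 b \<in> gr (s - (e 2 + e 3))" by (rule D_comp[OF mem(2)]) simp
  moreover have "D 3 a \<in> gr (s - (e 1 + e 3))" by (rule D_comp[OF mem(1)]) simp
  moreover have "D 1 b' \<in> gr (s - (e 1 + e 2))"
  proof (rule D_comp)
    show "b' \<in> gr (s - e 2)"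
      unfolding b'_def
      by (intro comp_mem mem X_comp[OF D_comp[OF mem(2), of "s - e 2 - e 3"]]) auto
  qed simp
  ultimately have "f = bd2 X (D 3 b, - D 3 a, - D 1 b')"
    and "(D 3 b, - D 3 a, - D 1 b') \<in> kos2 e gr s"
    by (auto simp: kos2_def comp_mem)
  then show ?thesis by blast
qed

text \<open>The potential is \<open>D 1 a\<close>. Division by variable 1 settles \<open>b\<close>
  and \<open>c\<close>; for \<open>a\<close> itself, variable 2 is cancelled from
  \<open>X 1 b = X 2 a\<close>.\<close>

lemma exact_bd2:
  assumes "p \<in> kos2 e gr s" "bd2 X p = 0"
  shows "p \<in> bd3 X ` kos3 e gr s"
proof -
  obtain a b c where p: "p = (a, b, c)" by (cases p)
  have mem: "a \<in> gr (s - (e 2 + e 3))"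
    and eq: "X 1 c = X 3 a" "X 1 b = X 2 a"
    using assms by (auto simp: p kos2_def bd2_def zero_prod_def)
  have b: "b = X 2 (D 1 a)" using D_X[of 1 b] by (simp add: eq D_X_comm)
  have c: "c = X 3 (D 1 a)" using D_X[of 1 c] by (simp add: eq D_X_comm)
  have "X 2 (X 1 (D 1 a)) = X 2 a" using eq(2) by (simp add: b X_comm)
  then have "X 1 (D 1 a) = a" by (metis D_X)
  then have "p = bd3 X (D 1 a)" by (simp add: p bd3_def flip: b c)
  moreover have "D 1 a \<in> kos3 e gr s"
    unfolding kos3_def by (intro D_comp[OF mem]) simp
  ultimately show ?thesis by blast
qed

end

text \<open>\<open>\<pi>\<close> takes the degree as an argument because, for the semigroup algebra,
  it reads off the coefficient at that degree. \<open>\<pi>_ker\<close> is minimality: the image of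
  \<open>bd1\<close> is the degree part of mF.\<close>

locale koszul_cover = F: free_koszul_module sc e X gr D + N: koszul_module sc' e X' gr'
  for sc :: "'k::field \<Rightarrow> 'm::ab_group_add \<Rightarrow> 'm" and e :: "3 \<Rightarrow> 'd::ab_group_add" and X gr D
    and sc' :: "'k \<Rightarrow> 'n::ab_group_add \<Rightarrow> 'n" and X' gr' +
  fixes \<pi> :: "'d \<Rightarrow> 'm \<Rightarrow> 'n"
  assumes \<pi>_diff: "v \<in> gr c \<Longrightarrow> w \<in> gr c \<Longrightarrow> \<pi> c (v - w) = \<pi> c v - \<pi> c w"
    and \<pi>_sc: "v \<in> gr c \<Longrightarrow> \<pi> c (sc k v) = sc' k (\<pi> c v)"
    and \<pi>_X: "v \<in> gr c \<Longrightarrow> c + e i = c' \<Longrightarrow> \<pi> c' (X i v) = X' i (\<pi> c v)"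
    and \<pi>_onto: "\<pi> c ` gr c = gr' c"
    and \<pi>_ker: "v \<in> gr c \<Longrightarrow> \<pi> c v = 0 \<Longrightarrow> v \<in> bd1 X ` kos1 e gr c"
begin

definition ker :: "'d \<Rightarrow> 'm set" where
  "ker c = {v \<in> gr c. \<pi> c v = 0}"

definition \<pi>1 :: "'d \<Rightarrow> 'm \<times> 'm \<times> 'm \<Rightarrow> 'n \<times> 'n \<times> 'n" where
  "\<pi>1 s = map_prod (\<pi> (s - e 1)) (map_prod (\<pi> (s - e 2)) (\<pi> (s - e 3)))"

definition \<pi>2 :: "'d \<Rightarrow> 'm \<times> 'm \<times> 'm \<Rightarrow> 'n \<times> 'n \<times> 'n" where
  "\<pi>2 s = map_prod (\<pi> (s - (e 2 + e 3))) (map_prod (\<pi> (s - (e 1 + e 3))) (\<pi> (s - (e 1 + e 2))))"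

definition \<pi>3 :: "'d \<Rightarrow> 'm \<Rightarrow> 'n" where
  "\<pi>3 s = \<pi> (s - (e 1 + e 2 + e 3))"

lemma \<pi>_0: "\<pi> c 0 = 0"
  using \<pi>_diff[of 0 c 0] F.comp_mem(1) by simp

lemma \<pi>_add: "v \<in> gr c \<Longrightarrow> w \<in> gr c \<Longrightarrow> \<pi> c (v + w) = \<pi> c v + \<pi> c w"
  using \<pi>_diff[of v c "0 - w"] \<pi>_diff[of 0 c w] F.comp_mem by (simp add: \<pi>_0)

text \<open>The kernel keeps the ambient type and the operators, so it can serve as the target of
  the next cover.\<close>

lemma koszul_module_ker: "koszul_module sc e X ker"
proof unfold_locales
  show "F.subspace (ker c)" for c
    unfolding F.subspace_def by (auto simp: ker_def F.comp_mem \<pi>_0 \<pi>_add \<pi>_sc)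
  show "X i v \<in> ker c'" if "v \<in> ker c" "c + e i = c'" for i v c c'
    using that by (auto simp: ker_def \<pi>_X N.X_0 intro: F.X_comp)
qed (simp_all add: F.X_simps F.X_comm)

lemma lin_on_\<pi>: "lin_on sc sc' (gr s) (\<pi> s)"
  by (auto simp: lin_on_def F.comp_mem \<pi>_diff \<pi>_sc)

lemma lin_on_\<pi>1: "lin_on (sc3 sc) (sc3 sc') (kos1 e gr s) (\<pi>1 s)"
  by (auto simp: lin_on_def F.comp_mem \<pi>_diff \<pi>_sc kos1_def sc3_def \<pi>1_def zero_prod_def minus_prod_def)

lemma lin_on_\<pi>2: "lin_on (sc3 sc) (sc3 sc') (kos2 e gr s) (\<pi>2 s)"
  by (auto simp: lin_on_def F.comp_mem \<pi>_diff \<pi>_sc kos2_def sc3_def \<pi>2_def zero_prod_def minus_prod_def)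

lemma \<pi>1_onto: "\<pi>1 s ` kos1 e gr s = kos1 e gr' s"
  by (simp add: \<pi>1_def kos1_def map_prod_surj_on[OF \<pi>_onto map_prod_surj_on[OF \<pi>_onto \<pi>_onto]])

lemma \<pi>2_onto: "\<pi>2 s ` kos2 e gr s = kos2 e gr' s"
  by (simp add: \<pi>2_def kos2_def map_prod_surj_on[OF \<pi>_onto map_prod_surj_on[OF \<pi>_onto \<pi>_onto]])

lemma \<pi>3_onto: "\<pi>3 s ` kos3 e gr s = kos3 e gr' s"
  by (simp add: \<pi>3_def kos3_def \<pi>_onto)

lemma \<pi>_bd1: "f \<in> kos1 e gr s \<Longrightarrow> \<pi> s (bd1 X f) = bd1 X' (\<pi>1 s f)"
  by (auto simp: kos1_def bd1_def \<pi>1_def intro!: F.X_comp F.comp_mem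
      \<pi>_add[THEN trans] arg_cong2[where f = "(+)"] \<pi>_X)

lemma \<pi>_bd2: "f \<in> kos2 e gr s \<Longrightarrow> \<pi>1 s (bd2 X f) = bd2 X' (\<pi>2 s f)"
  by (auto simp: kos2_def bd2_def \<pi>1_def \<pi>2_def intro!: F.X_comp
      \<pi>_diff[THEN trans] arg_cong2[where f = "(-)"] \<pi>_X)

lemma \<pi>_bd3: "f \<in> kos3 e gr s \<Longrightarrow> \<pi>2 s (bd3 X f) = bd3 X' (\<pi>3 s f)"
  by (auto simp: kos3_def bd3_def \<pi>2_def \<pi>3_def intro!: \<pi>_X)

lemma kos1_ker: "{f \<in> kos1 e gr s. \<pi>1 s f = 0} = kos1 e ker s"
  by (auto simp: kos1_def ker_def \<pi>1_def zero_prod_def)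

lemma kos2_ker: "{f \<in> kos2 e gr s. \<pi>2 s f = 0} = kos2 e ker s"
  by (auto simp: kos2_def ker_def \<pi>2_def zero_prod_def)

lemma has_qdim_H0:
  assumes "has_qdim sc (gr s) (bd1 X ` kos1 e gr s) r"
  shows "has_qdim sc' (gr' s) (bd1 X' ` kos1 e gr' s) r"
  using \<pi>_ker F.bd1_mem \<pi>_bd1
  by (intro has_qdim_coker[OF lin_on_\<pi> \<pi>_onto \<pi>1_onto F.lin_on_bd1 _ _ _ assms]) auto

lemma has_qdim_H1:
  assumes "has_qdim sc (ker s) (bd1 X ` kos1 e ker s) r"
  shows "has_qdim (sc3 sc') {m \<in> kos1 e gr' s. bd1 X' m = 0} (bd2 X' ` kos2 e gr' s) r"
proof (rule has_qdim_connecting[OF F.lin_on_bd1 F.bd1_mem F.bd2_mem lin_on_\<pi>1 \<pi>1_onto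
      lin_on_\<pi> \<pi>2_onto F.bd1_bd2 F.exact_bd1 \<pi>_bd1 \<pi>_bd2])
  \<comment> \<open>By minimality every element of the kernel is a boundary, so the connecting map
    starts from all of \<open>ker s\<close>.\<close>
  have "{z \<in> bd1 X ` kos1 e gr s. \<pi> s z = 0} = ker s"
    using \<pi>_ker F.bd1_mem unfolding ker_def by blast
  then show "has_qdim sc {z \<in> bd1 X ` kos1 e gr s. \<pi> s z = 0}
      (bd1 X ` {f \<in> kos1 e gr s. \<pi>1 s f = 0}) r"
    using assms by (simp add: kos1_ker)
qed auto

lemma has_qdim_H2:
  assumes "has_qdim (sc3 sc) {m \<in> kos1 e ker s. bd1 X m = 0} (bd2 X ` kos2 e ker s) r"
  shows "has_qdim (sc3 sc') {m \<in> kos2 e gr' s. bd2 X' m = 0} (bd3 X' ` kos3 e gr' s) r"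
proof (rule has_qdim_connecting[OF F.lin_on_bd2 F.bd2_mem F.bd3_mem lin_on_\<pi>2 \<pi>2_onto
      lin_on_\<pi>1 \<pi>3_onto F.bd2_bd3 F.exact_bd2 \<pi>_bd2 \<pi>_bd3])
  \<comment> \<open>Exactness at \<open>kos1\<close> identifies these boundaries with the cycles of
    the kernel.\<close>
  have "{z \<in> bd2 X ` kos2 e gr s. \<pi>1 s z = 0} = {m \<in> kos1 e ker s. bd1 X m = 0}"
    using F.exact_bd1 F.bd2_mem F.bd1_bd2 unfolding kos1_ker[symmetric] by fastforce
  then show "has_qdim (sc3 sc) {z \<in> bd2 X ` kos2 e gr s. \<pi>1 s z = 0}
      (bd2 X ` {f \<in> kos2 e gr s. \<pi>2 s f = 0}) r"
    using assms by (simp add: kos2_ker)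
qed (auto simp: sc3_def zero_prod_def)

end

section \<open>Graded free modules\<close>

definition cf :: "(nat \<Rightarrow>\<^sub>0 'k::zero poly3) \<Rightarrow> nat \<Rightarrow> nat ^ 3 \<Rightarrow> 'k" where
  "cf v j u = Poly_Mapping.lookup (Poly_Mapping.lookup v j) u"

definition of_cf :: "(nat \<Rightarrow> nat ^ 3 \<Rightarrow> 'k) \<Rightarrow> (nat \<Rightarrow>\<^sub>0 'k::zero poly3)" where
  "of_cf g = Abs_poly_mapping (\<lambda>j. Abs_poly_mapping (g j))"

lemma cf_eqI: "(\<And>j u. cf v j u = cf w j u) \<Longrightarrow> v = w"
  by (simp add: cf_def poly_mapping_eqI)

lemma finite_cf: "finite {(j, u). cf v j u \<noteq> 0}"
proof (rule finite_subset)
  show "{(j, u). cf v j u \<noteq> 0} \<subseteq>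
      (SIGMA j:Poly_Mapping.keys v. Poly_Mapping.keys (Poly_Mapping.lookup v j))"
    by (auto simp: cf_def in_keys_iff)
qed auto

lemma cf_of_cf:
  assumes fin: "finite {(j, u). g j u \<noteq> 0}"
  shows "cf (of_cf g) j u = g j u"
proof -
  have "finite {u. g j u \<noteq> 0}" for j
    by (rule finite_subset[OF _ finite_imageI[OF fin, of snd]]) force
  then have row: "Poly_Mapping.lookup (Abs_poly_mapping (g j)) = g j" for j
    by (simp add: lookup_Abs_poly_mapping)
  have "{j. Abs_poly_mapping (g j) \<noteq> 0} \<subseteq> fst ` {(j, u). g j u \<noteq> 0}"
  proof
    fix j assume "j \<in> {j. Abs_poly_mapping (g j) \<noteq> 0}"
    then obtain u where "g j u \<noteq> 0"
      using row[of j] by (metis (mono_tags) lookup_zero mem_Collect_eq poly_mapping_eqI)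
    then show "j \<in> fst ` {(j, u). g j u \<noteq> 0}" by force
  qed
  then have "finite {j. Abs_poly_mapping (g j) \<noteq> 0}" using fin finite_subset by blast
  then show ?thesis by (simp add: cf_def of_cf_def row)
qed

lemma cf_simps [simp]:
  fixes v w :: "nat \<Rightarrow>\<^sub>0 'k::ab_group_add poly3"
  shows "cf 0 j u = (0::'k)" "cf (v + w) j u = cf v j u + cf w j u"
    "cf (v - w) j u = cf v j u - cf w j u"
  by (simp_all add: cf_def lookup_add lookup_minus)

lemma cf_sum: "cf (\<Sum>i\<in>I. f i) j u = (\<Sum>i\<in>I. cf (f i) j u)"
  for f :: "'i \<Rightarrow> nat \<Rightarrow>\<^sub>0 'k::ab_group_add poly3"
  by (induction I rule: infinite_finite_induct) auto

section \<open>Multiplication by monomials, read on coefficients\<close>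

lemma lookup_free_scale:
  "Poly_Mapping.lookup (free_scale f v) j = f * Poly_Mapping.lookup v j"
  by (simp add: free_scale_def map.rep_eq when_def)

lemma poly_mapping_add_induct [case_names zero add]:
  assumes "P 0" and add: "\<And>f k v. P f \<Longrightarrow> P (f + Poly_Mapping.single k v)"
  shows "P (f :: 'a \<Rightarrow>\<^sub>0 'b::monoid_add)"
proof (induction f rule: update_induct)
  case (update f k v)
  have "Poly_Mapping.update k v f = f + Poly_Mapping.single k v"
    using update(1) by (intro poly_mapping_eqI)
      (auto simp: lookup_update lookup_add lookup_single when_def in_keys_iff)
  then show ?case using add update.IH by simp
qed (rule assms)

text \<open>By cancellation, \<open>u\<close> is the only exponent of \<open>f\<close> that
  contributes at \<open>b + u\<close>.\<close>

lemma lookup_single_mult_add: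
  fixes f :: "'a::cancel_comm_monoid_add \<Rightarrow>\<^sub>0 'k::comm_ring_1"
  shows "Poly_Mapping.lookup (Poly_Mapping.single b c * f) (b + u) = c * Poly_Mapping.lookup f u"
proof (induction f rule: poly_mapping_add_induct)
  case (add f k v)
  then show ?case by (simp add: distrib_left lookup_add mult_single lookup_single when_def)
qed simp

lemma lookup_single_mult_not:
  fixes f :: "'a::comm_monoid_add \<Rightarrow>\<^sub>0 'k::comm_ring_1"
  assumes "\<And>w. u \<noteq> b + w"
  shows "Poly_Mapping.lookup (Poly_Mapping.single b c * f) u = 0"
proof (induction f rule: poly_mapping_add_induct)
  case (add f k v)
  then show ?case
    using assms[of k] by (auto simp: distrib_left lookup_add mult_single lookup_single when_def)
qed simp

definition fsc :: "'k::field \<Rightarrow> (nat \<Rightarrow>\<^sub>0 'k poly3) \<Rightarrow> (nat \<Rightarrow>\<^sub>0 'k poly3)" where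
  "fsc k = free_scale (Poly_Mapping.single 0 k)"

definition fX :: "3 \<Rightarrow> (nat \<Rightarrow>\<^sub>0 'k::field poly3) \<Rightarrow> (nat \<Rightarrow>\<^sub>0 'k poly3)" where
  "fX i = free_scale (Poly_Mapping.single (axis i 1) 1)"

text \<open>
  \<open>fD i\<close> divides by the \<open>i\<close>-th variable and drops the terms that it does not divide.
\<close>

definition fD :: "3 \<Rightarrow> (nat \<Rightarrow>\<^sub>0 'k::field poly3) \<Rightarrow> (nat \<Rightarrow>\<^sub>0 'k poly3)" where
  "fD i v = of_cf (\<lambda>j u. cf v j (axis i 1 + u))"

lemma cf_fsc [simp]: "cf (fsc k v) j u = k * cf v j u"
  using lookup_single_mult_add[of 0 k _ u] by (simp add: cf_def fsc_def lookup_free_scale)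

text \<open>Subtraction of exponents is truncated, hence the separate case
  \<open>u $ i = 0\<close>.\<close>

lemma cf_fX: "cf (fX i v) j u = (if u $ i = 0 then 0 else cf v j (u - axis i 1))"
proof (cases "u $ i = 0")
  case True
  then have "u \<noteq> axis i 1 + w" for w by (auto simp: vec_eq_iff axis_def)
  then show ?thesis
    using True by (simp add: cf_def fX_def lookup_free_scale lookup_single_mult_not)
next
  case False
  then have "u = axis i 1 + (u - axis i 1)" by (auto simp: vec_eq_iff axis_def)
  then show ?thesis
    using False lookup_single_mult_add[of "axis i 1" 1 "Poly_Mapping.lookup v j" "u - axis i 1"]
    by (simp add: cf_def fX_def lookup_free_scale)
qed

lemma cf_fD [simp]: "cf (fD i v) j u = cf v j (axis i 1 + u)"
  unfolding fD_def
proof (rule cf_of_cf)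
  \<comment> \<open>The support is the preimage of a finite set under an injective shift.\<close>
  have "{(j, u). cf v j (axis i 1 + u) \<noteq> 0} = map_prod id ((+) (axis i 1)) -` {(j, u). cf v j u \<noteq> 0}"
    by auto
  moreover have "inj (map_prod id ((+) (axis i 1 :: nat ^ 3)))"
    by (intro prod.inj_map inj_on_id) (simp add: inj_def)
  ultimately show "finite {(j, u). cf v j (axis i 1 + u) \<noteq> 0}"
    using finite_vimageI[OF finite_cf] by metis
qed

lemma free_comp_iff:
  "v \<in> free_comp e ss c \<longleftrightarrow>
     (\<forall>j u. cf v j u \<noteq> 0 \<longrightarrow> j < length ss \<and> monom_degree e u + ss ! j = c)"
proof -
  have "Poly_Mapping.keys v \<subseteq> {..<length ss} \<longleftrightarrow> (\<forall>j u. cf v j u \<noteq> 0 \<longrightarrow> j < length ss)"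
    by (auto simp: cf_def subset_iff in_keys_iff poly_mapping_eq_iff fun_eq_iff)
  then show ?thesis by (auto simp: free_comp_def free_mod_def cf_def in_keys_iff)
qed

lemma irrelevant_mult_iff: "v \<in> irrelevant_mult ss \<longleftrightarrow> v \<in> free_mod ss \<and> (\<forall>j. cf v j 0 = 0)"
proof -
  have "cf v j 0 = 0" if "v \<in> free_mod ss" "\<not> j < length ss" for j
    using that by (auto simp: free_mod_def cf_def subset_iff in_keys_iff dest!: spec[of _ j])
  then show ?thesis by (auto simp: irrelevant_mult_def cf_def)
qed

lemma axis_add_diff: "u $ i \<noteq> 0 \<Longrightarrow> axis i (Suc 0) + (u - axis i (Suc 0)) = u" for u :: "nat ^ 3"
  by (auto simp: vec_eq_iff axis_def)

lemma cf_fX_fD: "cf (fX i (fD i v)) j u = (if u $ i = 0 then 0 else cf v j u)"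
  by (simp add: cf_fX axis_add_diff)

lemma monom_degree_add: "monom_degree e (u + w) = monom_degree e u + monom_degree e w"
  by (simp add: monom_degree_def sum.distrib[symmetric] vec_eq_iff algebra_simps)

lemma monom_degree_0 [simp]: "monom_degree e 0 = 0"
  by (simp add: monom_degree_def vec_eq_iff)

lemma monom_degree_axis [simp]: "monom_degree e (axis i (Suc 0)) = e i"
proof -
  have "monom_degree e (axis i (Suc 0)) = (\<Sum>j\<in>UNIV. if j = i then e j else 0)"
    unfolding monom_degree_def by (rule sum.cong) (auto simp: axis_def vec_eq_iff)
  then show ?thesis by simp
qed

lemma free_koszul_module_free_comp:
  "free_koszul_module (fsc :: 'k::field \<Rightarrow> _) e fX (free_comp e ss) fD"
proof (unfold_locales)
  fix k l :: 'k and v w :: "nat \<Rightarrow>\<^sub>0 'k poly3" and i j :: 3 and c c' :: "int ^ 3"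
  show "fsc k (v + w) = fsc k v + fsc k w" "fsc (k + l) v = fsc k v + fsc l v"
    "fsc k (fsc l v) = fsc (k * l) v" "fsc 1 v = v"
    by (auto intro!: cf_eqI simp: algebra_simps)
  show "fX i (v - w) = fX i v - fX i w" "fX i (fsc k v) = fsc k (fX i v)"
    "fD i (v - w) = fD i v - fD i w"
    by (auto intro!: cf_eqI simp: cf_fX)
  have swap: "u - a - b = u - b - a" for u a b :: "nat ^ 3"
    by (simp add: vec_eq_iff add.commute)
  show "fX i (fX j v) = fX j (fX i v)"
  proof (cases "i = j")
    case False
    then have "(axis i 1 :: nat ^ 3) $ j = 0" "(axis j 1 :: nat ^ 3) $ i = 0"
      by (simp_all add: axis_def)
    then show ?thesis by (intro cf_eqI) (simp add: cf_fX swap)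
  qed simp
  show "fD i (fX i v) = v"
    by (rule cf_eqI) (simp add: cf_fX)
  show "fD i (fX j v) = fX j (fD i v)" if "i \<noteq> j"
  proof -
    have "axis i 1 + u - axis j 1 = axis i 1 + (u - axis j 1 :: nat ^ 3)" for u
      using that by (auto simp: vec_eq_iff axis_def)
    moreover have "(axis i 1 :: nat ^ 3) $ j = 0" using that by (simp add: axis_def)
    ultimately show ?thesis by (intro cf_eqI) (simp add: cf_fX)
  qed
  show "fX i v \<in> free_comp e ss c'" if "v \<in> free_comp e ss c" "c + e i = c'"
    unfolding free_comp_iff
  proof (intro allI impI)
    fix j u assume "cf (fX i v) j u \<noteq> 0"
    then have *: "u $ i \<noteq> 0" "cf v j (u - axis i 1) \<noteq> 0" by (auto simp: cf_fX split: if_splits)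
    then have "monom_degree e (u - axis i 1) + ss ! j = c" "j < length ss"
      using that(1) unfolding free_comp_iff by blast+
    moreover have "monom_degree e u = e i + monom_degree e (u - axis i 1)"
      using monom_degree_add[of e "axis i 1" "u - axis i 1"] * by (simp add: axis_add_diff)
    ultimately show "j < length ss \<and> monom_degree e u + ss ! j = c'" using that(2) by auto
  qed
  show "fD i v \<in> free_comp e ss c'" if "v \<in> free_comp e ss c" "c = c' + e i"
    unfolding free_comp_iff
  proof (intro allI impI)
    fix j u assume "cf (fD i v) j u \<noteq> 0"
    then have "j < length ss \<and> monom_degree e (axis i 1 + u) + ss ! j = c"
      using that(1) unfolding free_comp_iff by simp
    moreover have "monom_degree e (axis i 1 + u) = e i + monom_degree e u"
      by (simp add: monom_degree_add)
    ultimately show "j < length ss \<and> monom_degree e u + ss ! j = c'"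
      using that(2) by (simp add: algebra_simps)
  qed
  show "module.subspace (fsc :: 'k \<Rightarrow> _) (free_comp e ss c)"
  proof -
    interpret vector_space "fsc :: 'k \<Rightarrow> _"
      by unfold_locales (auto intro!: cf_eqI simp: algebra_simps)
    have sum: "j < length ss \<and> monom_degree e u + ss ! j = c"
      if "v \<in> free_comp e ss c" "w \<in> free_comp e ss c" "cf v j u + cf w j u \<noteq> 0"
      for v w :: "nat \<Rightarrow>\<^sub>0 'k poly3" and j u
    proof -
      have "cf v j u \<noteq> 0 \<or> cf w j u \<noteq> 0" using that(3) by auto
      then show ?thesis using that(1,2) unfolding free_comp_iff by blast
    qed
    show ?thesis unfolding subspace_def
    proof (intro conjI ballI allI)
      fix v w :: "nat \<Rightarrow>\<^sub>0 'k poly3" assume "v \<in> free_comp e ss c" "w \<in> free_comp e ss c"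
      from sum[OF this] show "v + w \<in> free_comp e ss c" unfolding free_comp_iff[of "v + w"] by simp
    qed (auto simp: free_comp_iff)
  qed
qed

text \<open>A vector without constant terms is used up by splitting off the multiples of variable 1,
  then those of variable 2 from the rest, then those of variable 3.\<close>

lemma bd1_free_comp:
  "bd1 fX ` kos1 e (free_comp e ss) c = {v \<in> free_comp e ss c. \<forall>j. cf v j 0 = (0::'k::field)}"
proof (intro equalityI subsetI)
  interpret free_koszul_module "fsc :: 'k \<Rightarrow> _" e fX "free_comp e ss" fD
    by (rule free_koszul_module_free_comp)
  fix v :: "nat \<Rightarrow>\<^sub>0 'k poly3"
  {
    assume "v \<in> bd1 fX ` kos1 e (free_comp e ss) c"
    then show "v \<in> {v \<in> free_comp e ss c. \<forall>j. cf v j 0 = 0}"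
      using bd1_mem[of c] by (auto simp: bd1_def cf_fX)
  next
    assume v: "v \<in> {v \<in> free_comp e ss c. \<forall>j. cf v j 0 = 0}"
    define v' where "v' = v - fX 1 (fD 1 v)"
    define v'' where "v'' = v' - fX 2 (fD 2 v')"
    have D: "fD i w \<in> free_comp e ss (c - e i)" if "w \<in> free_comp e ss c" for i and w :: "nat \<Rightarrow>\<^sub>0 'k poly3"
      using D_comp[OF that] by simp
    have XD: "fX i (fD i w) \<in> free_comp e ss c" if "w \<in> free_comp e ss c" for i and w :: "nat \<Rightarrow>\<^sub>0 'k poly3"
      by (rule X_comp[OF D[OF that]]) simp
    have v': "v' \<in> free_comp e ss c" and v'': "v'' \<in> free_comp e ss c"
      using v unfolding v''_def v'_def by (auto intro!: comp_mem XD)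
    have "v'' - fX 3 (fD 3 v'') = 0"
    proof (rule cf_eqI)
      fix j and u :: "nat ^ 3"
      have "u = 0" if "u $ 1 = 0" "u $ 2 = 0" "u $ (3 :: 3) = 0"
        using that by (simp add: vec_eq_iff forall_3)
      then show "cf (v'' - fX 3 (fD 3 v'')) j u = cf 0 j u"
        using v by (auto simp: v''_def v'_def cf_fX_fD)
    qed
    then have "v = bd1 fX (fD 1 v, fD 2 v', fD 3 v'')"
      by (simp add: bd1_def v''_def v'_def algebra_simps)
    moreover have "(fD 1 v, fD 2 v', fD 3 v'') \<in> kos1 e (free_comp e ss) c"
      using v v' v'' D by (auto simp: kos1_def)
    ultimately show "v \<in> bd1 fX ` kos1 e (free_comp e ss) c" by blast
  }
qed

text \<open>Modulo mF only constant terms survive. In degree \<open>c\<close> these sit at the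
  positions whose shift is \<open>c\<close>, so the basis vectors at these positions represent a
  basis.\<close>

lemma has_qdim_free_comp:
  "has_qdim (fsc :: 'k::field \<Rightarrow> _) (free_comp e ss c) (bd1 fX ` kos1 e (free_comp e ss) c)
     (count (mset ss) c)"
proof -
  define J where "J = {j. j < length ss \<and> ss ! j = c}"
  define b :: "nat \<Rightarrow> nat \<Rightarrow>\<^sub>0 'k poly3" where "b = (\<lambda>j. Poly_Mapping.single j 1)"
  have cf_b: "cf (b j) i u = (if i = j \<and> u = 0 then 1 else 0)" for i j u
    by (simp add: cf_def b_def lookup_single when_def flip: single_one)
  have fin: "finite J" by (simp add: J_def)
  have cf_comb: "cf (\<Sum>j\<in>J. fsc (x j) (b j)) i 0 = (if i \<in> J then x i else 0)" for x i
  proof -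
    have "cf (\<Sum>j\<in>J. fsc (x j) (b j)) i 0 = (\<Sum>j\<in>J. if j = i then x j else 0)"
      unfolding cf_sum by (rule sum.cong) (auto simp: cf_b)
    then show ?thesis using fin by simp
  qed
  interpret free_koszul_module "fsc :: 'k \<Rightarrow> _" e fX "free_comp e ss" fD
    by (rule free_koszul_module_free_comp)
  have b: "b j \<in> free_comp e ss c" if "j \<in> J" for j
    using that unfolding free_comp_iff by (auto simp: J_def cf_b split: if_splits)
  have comb: "(\<Sum>j\<in>J. fsc (x j) (b j)) \<in> free_comp e ss c" for x
    using b by (intro subspace_sum subspace_comp comp_mem) auto
  have "basis_mod (fsc :: 'k \<Rightarrow> _) (free_comp e ss c) (bd1 fX ` kos1 e (free_comp e ss) c) J b"
    unfolding basis_mod_def bd1_free_comp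
  proof (intro conjI ballI allI impI)
    fix v :: "nat \<Rightarrow>\<^sub>0 'k poly3" assume v: "v \<in> free_comp e ss c"
    have "cf v i 0 = 0" if "i \<notin> J" for i
      using v that unfolding free_comp_iff J_def by fastforce
    then show "\<exists>x. v - (\<Sum>j\<in>J. fsc (x j) (b j)) \<in> {v \<in> free_comp e ss c. \<forall>j. cf v j 0 = 0}"
      using v comb by (intro exI[of _ "\<lambda>j. cf v j 0"]) (auto simp: cf_comb intro!: comp_mem)
  next
    fix x j assume "(\<Sum>j\<in>J. fsc (x j) (b j)) \<in> {v \<in> free_comp e ss c. \<forall>j. cf v j 0 = 0}" "j \<in> J"
    then show "x j = 0" using cf_comb[of x j] by auto
  qed (use b fin in auto)
  moreover have "card J = count (mset ss) c"
    by (simp add: J_def count_mset count_list_eq_length_filter length_filter_conv_card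
        conj_commute eq_commute)
  ultimately show ?thesis unfolding has_qdim_def by blast
qed

section \<open>Homogeneous components\<close>

text \<open>A grading given by its projections \<open>P\<close>. It mediates between
  \<open>graded_hom\<close>, which speaks of components, and exactness, which speaks of whole
  modules.\<close>

definition graded_proj ::
    "'m::ab_group_add set \<Rightarrow> ('d \<Rightarrow> 'm set) \<Rightarrow> ('d \<Rightarrow> 'm \<Rightarrow> 'm) \<Rightarrow> bool" where
  "graded_proj M Mc P \<longleftrightarrow> 0 \<in> M \<and> (\<forall>v\<in>M. \<forall>w\<in>M. v + w \<in> M) \<and>
     (\<forall>c v w. P c (v + w) = P c v + P c w) \<and>
     (\<forall>v\<in>M. \<exists>C. finite C \<and> v = (\<Sum>c\<in>C. P c v)) \<and>
     (\<forall>c. \<forall>v\<in>M. P c v \<in> Mc c) \<and> (\<forall>c. Mc c \<subseteq> M) \<and>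
     (\<forall>c c'. \<forall>v\<in>Mc c. P c' v = (if c' = c then v else 0))"

lemma graded_homD:
  assumes "graded_hom scM scN M N Mc Nc \<phi>"
  shows graded_hom_add: "v \<in> M \<Longrightarrow> w \<in> M \<Longrightarrow> \<phi> (v + w) = \<phi> v + \<phi> w"
    and graded_hom_scale: "v \<in> M \<Longrightarrow> \<phi> (scM r v) = scN r (\<phi> v)"
    and graded_hom_comp: "v \<in> Mc c \<Longrightarrow> \<phi> v \<in> Nc c"
  using assms unfolding graded_hom_def by blast+

lemma graded_hom_proj:
  assumes P: "graded_proj M Mc P" and Q: "graded_proj N Nc Q"
    and hom: "graded_hom scM scN M N Mc Nc \<phi>" and v: "v \<in> M"
  shows "\<phi> (P c v) = Q c (\<phi> v)"
proof -
  note add = graded_hom_add[OF hom] and comps = graded_hom_comp[OF hom]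
  have M0: "0 \<in> M" and MP: "\<And>c v. v \<in> M \<Longrightarrow> P c v \<in> Mc c"
    and Madd: "\<And>v w. v \<in> M \<Longrightarrow> w \<in> M \<Longrightarrow> v + w \<in> M" and McM: "\<And>c. Mc c \<subseteq> M"
    and Padd: "\<And>c v w. P c (v + w) = P c v + P c w"
    and Pid: "\<And>c c' v. v \<in> Mc c \<Longrightarrow> P c' v = (if c' = c then v else 0)"
    using P by (auto simp: graded_proj_def)
  have Qadd: "\<And>c v w. Q c (v + w) = Q c v + Q c w"
    and Qid: "\<And>c c' v. v \<in> Nc c \<Longrightarrow> Q c' v = (if c' = c then v else 0)"
    using Q by (auto simp: graded_proj_def)
  have 0: "\<phi> 0 = 0" "P c 0 = 0" "Q c 0 = 0"
    using add[OF M0 M0] Padd[of c 0 0] Qadd[of c 0 0] by simp_all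
  \<comment> \<open>Membership in \<open>M\<close> is carried along because \<open>\<phi>\<close> is
    additive only there.\<close>
  have sum: "\<phi> (P c (\<Sum>c'\<in>C. f c')) = Q c (\<phi> (\<Sum>c'\<in>C. f c')) \<and> (\<Sum>c'\<in>C. f c') \<in> M"
    if "finite C" "\<And>c'. f c' \<in> Mc c'" for C f
    using that(1)
  proof (induction C rule: finite_induct)
    case empty
    then show ?case using 0 M0 by simp
  next
    case (insert c' C)
    have f: "f c' \<in> M" using that(2) McM by blast
    have Pc: "P c (f c') \<in> M" "P c (\<Sum>c'\<in>C. f c') \<in> M" using MP McM f insert.IH by blast+
    have "\<phi> (P c (f c')) = Q c (\<phi> (f c'))"
      using Pid[OF that(2)[of c'], of c] Qid[OF comps[OF that(2)[of c']], of c] 0 by simp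
    then show ?case using insert f Pc by (simp add: Padd Qadd add Madd)
  qed
  obtain C where "finite C" "v = (\<Sum>c\<in>C. P c v)" using P v unfolding graded_proj_def by blast
  then show ?thesis using sum[of C "\<lambda>c. P c v"] MP[OF v] by simp
qed

text \<open>An arbitrary preimage of a homogeneous element may be replaced by its component of the
  same degree.\<close>

lemma graded_hom_lift:
  assumes P: "graded_proj M Mc P" and Q: "graded_proj N Nc Q"
    and hom: "graded_hom scM scN M N Mc Nc \<phi>" and "w \<in> Nc c" "w \<in> \<phi> ` M"
  shows "w \<in> \<phi> ` Mc c"
proof -
  obtain v where v: "v \<in> M" "w = \<phi> v" using assms by blast
  have "\<phi> (P c v) = Q c w" using graded_hom_proj[OF P Q hom v(1)] v(2) by simp
  also have "\<dots> = w" using Q \<open>w \<in> Nc c\<close> by (simp add: graded_proj_def)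
  finally show ?thesis using P v(1) by (auto simp: graded_proj_def)
qed

lemma free_mod_iff: "v \<in> free_mod ss \<longleftrightarrow> (\<forall>j u. cf v j u \<noteq> 0 \<longrightarrow> j < length ss)"
  by (auto simp: free_mod_def cf_def subset_iff in_keys_iff poly_mapping_eq_iff fun_eq_iff)

lemma free_mod_mem:
  fixes v w :: "nat \<Rightarrow>\<^sub>0 'k::ab_group_add poly3"
  assumes "v \<in> free_mod ss" "w \<in> free_mod ss"
  shows free_mod_add: "v + w \<in> free_mod ss" and free_mod_diff: "v - w \<in> free_mod ss"
proof -
  have "cf v j u = 0" "cf w j u = 0" if "\<not> j < length ss" for j u
    using assms that unfolding free_mod_iff by blast+
  then show "v + w \<in> free_mod ss" "v - w \<in> free_mod ss"
    unfolding free_mod_iff by force+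
qed

lemma free_comp_subset: "free_comp e ss c \<subseteq> free_mod ss"
  by (auto simp: free_comp_def)

text \<open>Beyond the list \<open>ss ! j\<close> is unspecified; vectors of
  \<open>free_mod ss\<close> have no coefficients there.\<close>

definition fproj :: "(3 \<Rightarrow> int ^ 3) \<Rightarrow> (int ^ 3) list \<Rightarrow> int ^ 3 \<Rightarrow>
    (nat \<Rightarrow>\<^sub>0 'k::field poly3) \<Rightarrow> (nat \<Rightarrow>\<^sub>0 'k poly3)" where
  "fproj e ss c v = of_cf (\<lambda>j u. if monom_degree e u + ss ! j = c then cf v j u else 0)"

lemma cf_fproj [simp]:
  "cf (fproj e ss c v) j u = (if monom_degree e u + ss ! j = c then cf v j u else 0)"
  unfolding fproj_def by (rule cf_of_cf[OF finite_subset[OF _ finite_cf[of v]]]) auto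

lemma graded_proj_free:
  "graded_proj (free_mod ss) (free_comp e ss) (fproj e ss :: _ \<Rightarrow> (nat \<Rightarrow>\<^sub>0 'k::field poly3) \<Rightarrow> _)"
  unfolding graded_proj_def
proof (intro conjI allI ballI)
  fix v :: "nat \<Rightarrow>\<^sub>0 'k poly3"
  define C where "C = (\<lambda>(j, u). monom_degree e u + ss ! j) ` {(j, u). cf v j u \<noteq> 0}"
  have fin: "finite C" unfolding C_def by (rule finite_imageI[OF finite_cf])
  have "v = (\<Sum>c\<in>C. fproj e ss c v)"
  proof (rule cf_eqI)
    fix j u
    have "cf v j u \<noteq> 0 \<Longrightarrow> monom_degree e u + ss ! j \<in> C" unfolding C_def by force
    then show "cf v j u = cf (\<Sum>c\<in>C. fproj e ss c v) j u"
      using fin by (auto simp: cf_sum)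
  qed
  with fin show "\<exists>C. finite C \<and> v = (\<Sum>c\<in>C. fproj e ss c v)" by blast
next
  fix v :: "nat \<Rightarrow>\<^sub>0 'k poly3" and c assume "v \<in> free_mod ss"
  then show "fproj e ss c v \<in> free_comp e ss c" by (auto simp: free_mod_iff free_comp_iff)
next
  fix c c' and v :: "nat \<Rightarrow>\<^sub>0 'k poly3" assume v: "v \<in> free_comp e ss c"
  show "fproj e ss c' v = (if c' = c then v else 0)"
  proof (rule cf_eqI)
    fix j u
    have "cf v j u = 0 \<or> monom_degree e u + ss ! j = c" using v unfolding free_comp_iff by blast
    then show "cf (fproj e ss c' v) j u = cf (if c' = c then v else 0) j u" by auto
  qed
qed (auto simp: free_mod_add free_comp_subset[THEN subsetD] free_mod_iff[of 0] intro!: cf_eqI)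

lemma graded_proj_semigroup_algebra:
  "graded_proj (semigroup_algebra S) (semigroup_algebra_comp S)
     (\<lambda>c m. Poly_Mapping.single c (Poly_Mapping.lookup m c) :: 'k::field laurent3)"
  unfolding graded_proj_def
proof (intro conjI allI ballI)
  fix m :: "'k laurent3"
  have "m = (\<Sum>c\<in>Poly_Mapping.keys m. Poly_Mapping.single c (Poly_Mapping.lookup m c))"
    by (intro poly_mapping_eqI) (auto simp: lookup_sum lookup_single when_def in_keys_iff)
  then show "\<exists>C. finite C \<and> m = (\<Sum>c\<in>C. Poly_Mapping.single c (Poly_Mapping.lookup m c))"
    using finite_keys by blast
next
  fix m m' :: "'k laurent3"
  assume "m \<in> semigroup_algebra S" "m' \<in> semigroup_algebra S"
  then show "m + m' \<in> semigroup_algebra S"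
    using Poly_Mapping.keys_add[of m m'] by (auto simp: semigroup_algebra_def)
next
  fix c c' and m :: "'k laurent3" assume "m \<in> semigroup_algebra_comp S c"
  then have "Poly_Mapping.lookup m t = 0" if "t \<noteq> c" for t
    using that by (auto simp: semigroup_algebra_comp_def in_keys_iff subset_iff)
  then show "Poly_Mapping.single c' (Poly_Mapping.lookup m c') = (if c' = c then m else 0)"
    by (auto intro!: poly_mapping_eqI simp: lookup_single when_def)
qed (auto simp: semigroup_algebra_def semigroup_algebra_comp_def lookup_add single_add in_keys_iff
    split: if_splits)

section \<open>The covers of a minimal resolution\<close>

lemma graded_hom_diff:
  fixes \<phi> :: "(nat \<Rightarrow>\<^sub>0 'k::field poly3) \<Rightarrow> 'n::ab_group_add"
  assumes "graded_hom scM scN (free_mod ss) N Mc Nc \<phi>" "v \<in> free_mod ss" "w \<in> free_mod ss"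
  shows "\<phi> (v - w) = \<phi> v - \<phi> w"
proof -
  have "\<phi> ((v - w) + w) = \<phi> (v - w) + \<phi> w"
    by (rule graded_hom_add[OF assms(1) free_mod_diff[OF assms(2,3)] assms(3)])
  then show ?thesis by simp
qed

text \<open>Here \<open>K\<close> is the preceding syzygy module, given by its components;
  \<open>min\<close> comes from exactness and the minimality of the next differential.\<close>

lemma koszul_cover_free:
  fixes d :: "(nat \<Rightarrow>\<^sub>0 'k::field poly3) \<Rightarrow> (nat \<Rightarrow>\<^sub>0 'k poly3)"
  assumes K: "koszul_module fsc e fX K"
    and hom: "graded_hom free_scale free_scale (free_mod ss) (free_mod tt)
        (free_comp e ss) (free_comp e tt) d"
    and onto: "\<And>c. d ` free_comp e ss c = K c"
    and min: "{v \<in> free_mod ss. d v = 0} \<subseteq> irrelevant_mult ss"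
  shows "koszul_cover fsc e fX (free_comp e ss) fD fsc fX K (\<lambda>_. d)"
proof -
  interpret F: free_koszul_module "fsc :: 'k \<Rightarrow> _" e fX "free_comp e ss" fD
    by (rule free_koszul_module_free_comp)
  interpret N: koszul_module "fsc :: 'k \<Rightarrow> _" e fX K by (rule K)
  note scale = graded_hom_scale[OF hom]
  have mem: "v \<in> free_mod ss" if "v \<in> free_comp e ss c" for v :: "nat \<Rightarrow>\<^sub>0 'k poly3" and c
    using that free_comp_subset by blast
  show ?thesis
  proof unfold_locales
    show "v \<in> bd1 fX ` kos1 e (free_comp e ss) c" if "v \<in> free_comp e ss c" "d v = 0" for v c
    proof -
      have "v \<in> irrelevant_mult ss" using min mem[OF that(1)] that(2) by blast
      then show ?thesis using that(1) by (simp add: bd1_free_comp irrelevant_mult_iff)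
    qed
  qed (simp_all add: onto fsc_def fX_def scale mem graded_hom_diff[OF hom])
qed

text \<open>
  The graded pieces of the semigroup algebra, with \<open>x t\<^sup>c\<close> encoded by its coefficient \<open>x\<close>; the
  variables then act as the identity.
\<close>

definition kcomp :: "'d set \<Rightarrow> 'd \<Rightarrow> 'k::field set" where
  "kcomp S c = {x. c \<in> S \<or> x = 0}"

lemma koszul_module_kcomp:
  assumes "\<forall>s\<in>S. \<forall>i. s + e i \<in> S"
  shows "koszul_module ((*) :: 'k::field \<Rightarrow> _) e (\<lambda>_ x. x) (kcomp S)"
  by unfold_locales (use assms in \<open>auto simp: kcomp_def vector_space_over_itself.subspace_def\<close>)

lemma poly_to_laurent_single:
  "poly_to_laurent e (Poly_Mapping.single u k) = Poly_Mapping.single (monom_degree e u) k"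
  by (simp add: poly_to_laurent_def)

text \<open>In degree \<open>c\<close> the value \<open>aug v\<close> is a scalar multiple of t^c,
  so its coefficient determines it, and multiplication by a variable keeps this coefficient. The
  second claim converts the kernel of the coefficient map into the kernel of
  \<open>aug\<close>.\<close>

lemma koszul_cover_aug:
  fixes aug :: "(nat \<Rightarrow>\<^sub>0 'k::field poly3) \<Rightarrow> 'k laurent3"
  assumes S: "\<forall>s\<in>S. \<forall>i. s + e i \<in> S"
    and hom: "graded_hom free_scale (alg_scale e) (free_mod ss) (semigroup_algebra S)
       (free_comp e ss) (semigroup_algebra_comp S) aug"
    and onto: "aug ` free_mod ss = semigroup_algebra S"
    and min: "{v \<in> free_mod ss. aug v = 0} \<subseteq> irrelevant_mult ss"
  shows "koszul_cover fsc e fX (free_comp e ss) fD (*) (\<lambda>_ x. x) (kcomp S)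
    (\<lambda>c v. Poly_Mapping.lookup (aug v) c)"
    and "\<And>v c. v \<in> free_comp e ss c \<Longrightarrow> Poly_Mapping.lookup (aug v) c = 0 \<longleftrightarrow> aug v = 0"
proof -
  interpret F: free_koszul_module "fsc :: 'k \<Rightarrow> _" e fX "free_comp e ss" fD
    by (rule free_koszul_module_free_comp)
  interpret N: koszul_module "(*) :: 'k \<Rightarrow> _" e "\<lambda>_ x. x" "kcomp S"
    by (rule koszul_module_kcomp[OF S])
  have mem: "v \<in> free_mod ss" if "v \<in> free_comp e ss c" for v :: "nat \<Rightarrow>\<^sub>0 'k poly3" and c
    using that free_comp_subset by blast
  have scale: "aug (free_scale (Poly_Mapping.single u k) v) =
      Poly_Mapping.single (monom_degree e u) k * aug v" if "v \<in> free_mod ss" for u k v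
    using graded_hom_scale[OF hom that] by (simp add: alg_scale_def poly_to_laurent_single)
  note aug_comp = graded_hom_comp[OF hom]
  show inj: "Poly_Mapping.lookup (aug v) c = 0 \<longleftrightarrow> aug v = 0" if "v \<in> free_comp e ss c" for v c
    using aug_comp[OF that]
    by (auto simp: semigroup_algebra_comp_def subset_iff in_keys_iff intro!: poly_mapping_eqI)
  show "koszul_cover fsc e fX (free_comp e ss) fD (*) (\<lambda>_ x. x) (kcomp S)
    (\<lambda>c v. Poly_Mapping.lookup (aug v) c)"
  proof unfold_locales
    show "Poly_Mapping.lookup (aug (v - w)) c = Poly_Mapping.lookup (aug v) c - Poly_Mapping.lookup (aug w) c"
      if "v \<in> free_comp e ss c" "w \<in> free_comp e ss c" for v w c
      using that by (simp add: graded_hom_diff[OF hom] mem lookup_minus)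
    show "Poly_Mapping.lookup (aug (fsc k v)) c = k * Poly_Mapping.lookup (aug v) c"
      if "v \<in> free_comp e ss c" for v k c
      using lookup_single_mult_add[of 0 k "aug v" c] that by (simp add: fsc_def scale mem)
    show "Poly_Mapping.lookup (aug (fX i v)) c' = Poly_Mapping.lookup (aug v) c"
      if "v \<in> free_comp e ss c" "c + e i = c'" for v i c c'
      using lookup_single_mult_add[of "e i" 1 "aug v" c] that
      by (simp add: fX_def scale mem add.commute)
    show "(\<lambda>v. Poly_Mapping.lookup (aug v) c) ` free_comp e ss c = kcomp S c" for c
    proof (intro equalityI subsetI)
      fix x :: 'k assume "x \<in> kcomp S c"
      then have x: "Poly_Mapping.single c x \<in> semigroup_algebra_comp S c"
        by (auto simp: kcomp_def semigroup_algebra_comp_def semigroup_algebra_def)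
      then have "Poly_Mapping.single c x \<in> aug ` free_mod ss"
        by (simp add: onto semigroup_algebra_comp_def)
      then obtain v where "v \<in> free_comp e ss c" "aug v = Poly_Mapping.single c x"
        using graded_hom_lift[OF graded_proj_free graded_proj_semigroup_algebra hom x] by auto
      then show "x \<in> (\<lambda>v. Poly_Mapping.lookup (aug v) c) ` free_comp e ss c"
        by (intro image_eqI[of _ _ v]) simp_all
    next
      fix x assume "x \<in> (\<lambda>v. Poly_Mapping.lookup (aug v) c) ` free_comp e ss c"
      then obtain v where "v \<in> free_comp e ss c" "x = Poly_Mapping.lookup (aug v) c" by auto
      then show "x \<in> kcomp S c" using aug_comp[of v c]
        by (auto simp: kcomp_def semigroup_algebra_comp_def semigroup_algebra_def subset_iff in_keys_iff)
    qed
    show "v \<in> bd1 fX ` kos1 e (free_comp e ss) c"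
      if "v \<in> free_comp e ss c" "Poly_Mapping.lookup (aug v) c = 0" for v c
    proof -
      have "v \<in> irrelevant_mult ss" using min mem[OF that(1)] inj[OF that(1)] that(2) by blast
      then show ?thesis using that(1) by (simp add: bd1_free_comp irrelevant_mult_iff)
    qed
  qed
qed

lemma minimal_resolution_has_qdim:
  fixes F :: "nat \<Rightarrow> (int ^ 3) list"
    and d :: "nat \<Rightarrow> (nat \<Rightarrow>\<^sub>0 'k::field poly3) \<Rightarrow> (nat \<Rightarrow>\<^sub>0 'k poly3)"
  assumes S: "\<forall>s\<in>S. \<forall>i. s + e i \<in> S"
    and res: "minimal_graded_free_resolution S e p F d aug"
  defines "X \<equiv> \<lambda>_ :: 3. \<lambda>x :: 'k. x"
  shows "has_qdim (*) (kcomp S s) (bd1 X ` kos1 e (kcomp S) s) (count (mset (F 0)) s)"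
    and "has_qdim (sc3 (*)) {m \<in> kos1 e (kcomp S) s. bd1 X m = 0} (bd2 X ` kos2 e (kcomp S) s)
      (count (mset (F 1)) s)"
    and "has_qdim (sc3 (*)) {m \<in> kos2 e (kcomp S) s. bd2 X m = 0} (bd3 X ` kos3 e (kcomp S) s)
      (count (mset (F 2)) s)"
proof -
  have hom_aug: "graded_hom free_scale (alg_scale e) (free_mod (F 0)) (semigroup_algebra S)
       (free_comp e (F 0)) (semigroup_algebra_comp S) aug"
    and hom: "\<And>i. graded_hom free_scale free_scale (free_mod (F (Suc i))) (free_mod (F i))
       (free_comp e (F (Suc i))) (free_comp e (F i)) (d i)"
    and onto: "aug ` free_mod (F 0) = semigroup_algebra S"
    and ex0: "{v \<in> free_mod (F 0). aug v = 0} = d 0 ` free_mod (F 1)"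
    and ex: "\<And>i. {v \<in> free_mod (F (Suc i)). d i v = 0} = d (Suc i) ` free_mod (F (Suc (Suc i)))"
    and min: "\<And>i. d i ` free_mod (F (Suc i)) \<subseteq> irrelevant_mult (F i)"
    using res unfolding minimal_graded_free_resolution_def graded_free_resolution_def by simp_all
  note d_comp = graded_hom_comp[OF hom]
  have image: "d i ` free_comp e (F (Suc i)) c =
      {v \<in> free_comp e (F i) c. v \<in> d i ` free_mod (F (Suc i))}" for i c
  proof (intro equalityI subsetI)
    fix v assume "v \<in> {v \<in> free_comp e (F i) c. v \<in> d i ` free_mod (F (Suc i))}"
    then show "v \<in> d i ` free_comp e (F (Suc i)) c"
      using graded_hom_lift[OF graded_proj_free graded_proj_free hom[of i], of v c] by simp
  next
    fix v assume "v \<in> d i ` free_comp e (F (Suc i)) c"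
    then obtain w where w: "w \<in> free_comp e (F (Suc i)) c" "v = d i w" by blast
    then show "v \<in> {v \<in> free_comp e (F i) c. v \<in> d i ` free_mod (F (Suc i))}"
      using d_comp[OF w(1)] free_comp_subset[of e "F (Suc i)" c] by blast
  qed
  have min0: "{v \<in> free_mod (F 0). aug v = 0} \<subseteq> irrelevant_mult (F 0)"
    using ex0 min[of 0] by simp
  have min': "{v \<in> free_mod (F (Suc i)). d i v = 0} \<subseteq> irrelevant_mult (F (Suc i))" for i
    using ex min by simp
  note cover = koszul_cover_aug[OF S hom_aug onto min0]
  interpret C0: koszul_cover "fsc :: 'k \<Rightarrow> _" e fX "free_comp e (F 0)" fD "(*)" "\<lambda>_ x. x"
    "kcomp S" "\<lambda>c v. Poly_Mapping.lookup (aug v) c"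
    by (rule cover(1))
  \<comment> \<open>Exactness at \<open>F 0\<close>, cut down to degree \<open>c\<close>: the
    components of the first syzygy module are the image of \<open>d 0\<close>, so \<open>d 0\<close>
    covers them.\<close>
  have ker0: "d 0 ` free_comp e (F (Suc 0)) c = C0.ker c" for c
  proof -
    have "v \<in> d 0 ` free_mod (F (Suc 0)) \<longleftrightarrow> Poly_Mapping.lookup (aug v) c = 0"
      if v: "v \<in> free_comp e (F 0) c" for v
      using ex0 free_comp_subset[of e "F 0" c] v by (auto simp: cover(2)[OF v] simp flip: ex0)
    then show ?thesis unfolding image C0.ker_def by blast
  qed
  interpret C1: koszul_cover "fsc :: 'k \<Rightarrow> _" e fX "free_comp e (F (Suc 0))" fD "fsc :: 'k \<Rightarrow> _" fX
    "C0.ker" "\<lambda>_. d 0"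
    by (rule koszul_cover_free[OF C0.koszul_module_ker hom ker0 min'])
  have ker1: "d (Suc 0) ` free_comp e (F (Suc (Suc 0))) c = C1.ker c" for c
    unfolding image C1.ker_def ex[of 0, symmetric] using free_comp_subset[of e "F (Suc 0)" c] by blast
  interpret C2: koszul_cover "fsc :: 'k \<Rightarrow> _" e fX "free_comp e (F (Suc (Suc 0)))" fD
    "fsc :: 'k \<Rightarrow> _" fX "C1.ker" "\<lambda>_. d (Suc 0)"
    by (rule koszul_cover_free[OF C1.koszul_module_ker hom ker1 min'])
  show "has_qdim (*) (kcomp S s) (bd1 X ` kos1 e (kcomp S) s) (count (mset (F 0)) s)"
    unfolding X_def by (rule C0.has_qdim_H0[OF has_qdim_free_comp])
  show "has_qdim (sc3 (*)) {m \<in> kos1 e (kcomp S) s. bd1 X m = 0} (bd2 X ` kos2 e (kcomp S) s)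
      (count (mset (F 1)) s)"
    unfolding X_def One_nat_def
    by (rule C0.has_qdim_H1[OF C1.has_qdim_H0[OF has_qdim_free_comp]])
  show "has_qdim (sc3 (*)) {m \<in> kos2 e (kcomp S) s. bd2 X m = 0} (bd3 X ` kos3 e (kcomp S) s)
      (count (mset (F 2)) s)"
    unfolding X_def numeral_2_eq_2
    \<comment> \<open>Read from the inside: H_0 of the second syzygies, H_1 of the first, H_2 of the
      semigroup algebra.\<close>
    by (rule C0.has_qdim_H2[OF C1.has_qdim_H1[OF C2.has_qdim_H0[OF has_qdim_free_comp]]])
qed

section \<open>The Koszul homology of the semigroup algebra\<close>

lemma vector_space_sc3:
  assumes "vector_space sc"
  shows "vector_space (sc3 sc)"
proof -
  interpret vector_space sc by (rule assms)
  show ?thesis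
    by unfold_locales
      (auto simp: sc3_def plus_prod_def scale_right_distrib scale_left_distrib)
qed

text \<open>Applied to boundary maps: \<open>has_qdim_unique\<close> needs the boundaries to form a
  subspace.\<close>

lemma subspace_image:
  assumes "vector_space sc'" "lin_on sc sc' A f"
  shows "module.subspace sc' (f ` A)"
proof -
  interpret vector_space sc' by (rule assms)
  note f = lin_onD[OF assms(2)]
  show ?thesis unfolding subspace_def
    by (auto simp: image_iff) (metis f(1,2), metis f(4,6), metis f(7,8))
qed

lemma vector_space_mult: "vector_space ((*) :: 'k::field \<Rightarrow> _)"
  by unfold_locales (auto simp: algebra_simps)

lemma exists_3: "(\<exists>i::3. P i) \<longleftrightarrow> P 1 \<or> P 2 \<or> P 3"
  by (metis exhaust_3)

lemma exists_distinct_3: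
  "(\<exists>i j k :: 3. distinct [i, j, k] \<and> P i j k) \<longleftrightarrow>
     P 1 2 3 \<or> P 1 3 2 \<or> P 2 1 3 \<or> P 2 3 1 \<or> P 3 1 2 \<or> P 3 2 1"
  by (simp add: exists_3)

section \<open>The simplicial complex on three vertices attached to a degree\<close>

locale ray_closed =
  fixes S :: "(int ^ 3) set" and e :: "3 \<Rightarrow> int ^ 3"
  assumes closed: "s \<in> S \<Longrightarrow> s + e i \<in> S"
begin

text \<open>Closure under adding \<open>e i\<close> makes the family of faces closed under passing
  to subsets.\<close>

lemma edge_vertices:
  assumes "s - (e i + e j) \<in> S"
  shows "s - e i \<in> S" "s - e j \<in> S"
  using closed[OF assms, of i] closed[OF assms, of j] by (simp_all add: algebra_simps)

lemma vertex_mem: "s - e i \<in> S \<Longrightarrow> s \<in> S"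
  using closed[of "s - e i" i] by simp

text \<open>Reduced homology in dimension -1 survives only if the empty face is alone; any vertex
  present bounds it.\<close>

lemma has_qdim_kcomp_H0:
  "has_qdim (*) (kcomp S s :: 'k::field set) (bd1 (\<lambda>_ x. x) ` kos1 e (kcomp S) s)
     (if s \<in> apery S e then 1 else 0)"
proof -
  note has_qdim_1 = vector_space.has_qdim_1[OF vector_space_mult]
    and has_qdim_0 = vector_space.has_qdim_0[OF vector_space_mult]
  show ?thesis
  proof (cases "s \<in> apery S e")
    case True
    then have "bd1 (\<lambda>_ x. x) ` kos1 e (kcomp S) s = {0 :: 'k}" "1 \<in> (kcomp S s :: 'k set)"
      by (auto simp: apery_def bd1_def kos1_def kcomp_def)
    then show ?thesis using True using has_qdim_1[of "1 :: 'k" "kcomp S s" "{0}"] by auto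
  next
    case False
    have "x \<in> bd1 (\<lambda>_ x. x) ` kos1 e (kcomp S) s" if x: "x \<in> kcomp S s" for x :: 'k
    proof (cases "x = 0")
      case False
      then obtain i where "s - e i \<in> S"
        using x \<open>s \<notin> apery S e\<close> by (auto simp: apery_def kcomp_def)
      then have "s - e 1 \<in> S \<or> s - e 2 \<in> S \<or> s - e 3 \<in> S" by (metis exhaust_3)
      then have "\<exists>f\<in>{(x, 0, 0), (0, x, 0), (0, 0, x)}. f \<in> kos1 e (kcomp S) s"
        by (auto simp: kos1_def kcomp_def)
      then show ?thesis by (auto simp: bd1_def image_iff intro: rev_bexI)
    qed (auto simp: bd1_def kos1_def kcomp_def intro: image_eqI[of _ _ "(0, 0, 0)"])
    then show ?thesis using False by (auto intro!: has_qdim_0)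
  qed
qed

text \<open>The complex is an edge together with an isolated point.\<close>

lemma exc31_iff:
  "s \<in> exc31 S e \<longleftrightarrow> (\<forall>i. s - e i \<in> S) \<and>
     (s - (e 1 + e 2) \<in> S \<and> s - (e 1 + e 3) \<notin> S \<and> s - (e 2 + e 3) \<notin> S \<or>
      s - (e 1 + e 2) \<notin> S \<and> s - (e 1 + e 3) \<in> S \<and> s - (e 2 + e 3) \<notin> S \<or>
      s - (e 1 + e 2) \<notin> S \<and> s - (e 1 + e 3) \<notin> S \<and> s - (e 2 + e 3) \<in> S)"
  unfolding exc31_def exists_distinct_3
  using vertex_mem[of s 1]
  by (auto simp: add.commute[of "e 2" "e 1"] add.commute[of "e 3" "e 1"]
      add.commute[of "e 3" "e 2"])

text \<open>The complex consists of two isolated points; edges at the missing vertex are excluded by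
  \<open>edge_vertices\<close>.\<close>

lemma exc20_iff:
  "s \<in> exc20 S e \<longleftrightarrow>
     s - e 1 \<in> S \<and> s - e 2 \<in> S \<and> s - e 3 \<notin> S \<and> s - (e 1 + e 2) \<notin> S \<or>
     s - e 1 \<in> S \<and> s - e 2 \<notin> S \<and> s - e 3 \<in> S \<and> s - (e 1 + e 3) \<notin> S \<or>
     s - e 1 \<notin> S \<and> s - e 2 \<in> S \<and> s - e 3 \<in> S \<and> s - (e 2 + e 3) \<notin> S"
  unfolding exc20_def exists_distinct_3
  using vertex_mem[of s 1] vertex_mem[of s 2]
  by (auto simp: add.commute[of "e 2" "e 1"] add.commute[of "e 3" "e 1"]
      add.commute[of "e 3" "e 2"])

lemma exc30_iff:
  "s \<in> exc30 S e \<longleftrightarrow> s - e 1 \<in> S \<and> s - e 2 \<in> S \<and> s - e 3 \<in> S \<and>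
     s - (e 1 + e 2) \<notin> S \<and> s - (e 1 + e 3) \<notin> S \<and> s - (e 2 + e 3) \<notin> S"
  unfolding exc30_def forall_3 using vertex_mem[of s 1]
  by (auto simp: add.commute[of "e 2" "e 1"] add.commute[of "e 3" "e 1"]
      add.commute[of "e 3" "e 2"])

text \<open>The complex is the hollow triangle: its edges force the vertices and \<open>s\<close>
  into \<open>S\<close>.\<close>

lemma exc33_iff:
  "s \<in> exc33 S e \<longleftrightarrow> s - (e 1 + e 2) \<in> S \<and> s - (e 1 + e 3) \<in> S \<and> s - (e 2 + e 3) \<in> S \<and>
     s - (e 1 + e 2 + e 3) \<notin> S"
  unfolding exc33_def forall_3
  using vertex_mem[of s 1] edge_vertices[of s 1 2] edge_vertices[of s 2 3]
  by (auto simp: add.commute[of "e 2" "e 1"] add.commute[of "e 3" "e 1"]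
      add.commute[of "e 3" "e 2"])

text \<open>With the variables acting as the identity, a cycle has three equal components, so a
  missing edge makes it zero, and the filled triangle makes it a boundary.\<close>

lemma has_qdim_kcomp_H2:
  "has_qdim (sc3 (*)) {m \<in> kos2 e (kcomp S) s. bd2 (\<lambda>_ x. x) m = (0 :: 'k::field \<times> _)}
     (bd3 (\<lambda>_ x. x) ` kos3 e (kcomp S) s) (if s \<in> exc33 S e then 1 else 0)"
  (is "has_qdim _ ?Z ?B _")
proof -
  interpret vector_space "sc3 ((*) :: 'k \<Rightarrow> _)" by (rule vector_space_sc3[OF vector_space_mult])
  have Z: "?Z = {m. \<exists>x. m = (x, x, x) \<and> (x = 0 \<or>
      s - (e 1 + e 2) \<in> S \<and> s - (e 1 + e 3) \<in> S \<and> s - (e 2 + e 3) \<in> S)}"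
    by (auto simp: kos2_def bd2_def kcomp_def zero_prod_def)
  have B: "?B = {m. \<exists>x. m = (x, x, x) \<and> (x = 0 \<or> s - (e 1 + e 2 + e 3) \<in> S)}"
    by (auto simp: kos3_def bd3_def kcomp_def)
  show ?thesis
  proof (cases "s \<in> exc33 S e")
    case True
    then have E: "s - (e 1 + e 2) \<in> S" "s - (e 1 + e 3) \<in> S" "s - (e 2 + e 3) \<in> S"
      "s - (e 1 + e 2 + e 3) \<notin> S" by (simp_all add: exc33_iff)
    have "has_qdim (sc3 (*)) ?Z ?B 1" unfolding Z B
    proof (rule has_qdim_1[of "(1, 1, 1)"])
      fix v :: "'k \<times> 'k \<times> 'k"
      assume "v \<in> {m. \<exists>x. m = (x, x, x) \<and> (x = 0 \<or>
        s - (e 1 + e 2) \<in> S \<and> s - (e 1 + e 3) \<in> S \<and> s - (e 2 + e 3) \<in> S)}"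
      then obtain x where "v = (x, x, x)" by auto
      then show "\<exists>x. v - sc3 (*) x (1, 1, 1) \<in>
          {m. \<exists>x. m = (x, x, x) \<and> (x = 0 \<or> s - (e 1 + e 2 + e 3) \<in> S)}"
        by (intro exI[of _ x]) (simp add: sc3_def zero_prod_def)
    qed (use E in \<open>auto simp: sc3_def\<close>)
    then show ?thesis using True by simp
  next
    case False
    then have "?Z \<subseteq> ?B" unfolding Z B exc33_iff by auto
    then show ?thesis using False by (simp add: has_qdim_0)
  qed
qed

text \<open>Cycles are the vectors of sum zero supported on the vertices present; boundaries are
  spanned by the differences along the edges. For a nonempty complex the quotient has dimension one
  less than the number of components.\<close>

lemma has_qdim_kcomp_H1:
  "has_qdim (sc3 (*)) {m \<in> kos1 e (kcomp S) s. bd1 (\<lambda>_ x. x) m = (0 :: 'k::field)}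
     (bd2 (\<lambda>_ x. x) ` kos2 e (kcomp S) s)
     (if s \<in> exc30 S e then 2 else if s \<in> exc31 S e \<or> s \<in> exc20 S e then 1 else 0)"
  (is "has_qdim _ ?Z ?B _")
proof -
  interpret vector_space "sc3 ((*) :: 'k \<Rightarrow> _)" by (rule vector_space_sc3[OF vector_space_mult])
  define Zs :: "('k \<times> 'k \<times> 'k) set" where "Zs = ?Z"
  define Bs :: "('k \<times> 'k \<times> 'k) set" where "Bs = ?B"
  let ?V = "\<lambda>i. s - e i \<in> S"
  let ?E = "\<lambda>i j. s - (e i + e j) \<in> S"
  note V = edge_vertices[of s 1 2] edge_vertices[of s 1 3] edge_vertices[of s 2 3]
  have V': "?E 1 2 \<longrightarrow> ?V 1 \<and> ?V 2" "?E 1 3 \<longrightarrow> ?V 1 \<and> ?V 3" "?E 2 3 \<longrightarrow> ?V 2 \<and> ?V 3"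
    using V by blast+
  have Z: "(x, y, z) \<in> Zs \<longleftrightarrow> (?V 1 \<or> x = 0) \<and> (?V 2 \<or> y = 0) \<and> (?V 3 \<or> z = 0) \<and> x + y + z = 0"
    for x y z by (auto simp: Zs_def kos1_def bd1_def kcomp_def)
  have B: "(x, y, z) \<in> Bs \<longleftrightarrow> (\<exists>a b c. (?E 2 3 \<or> a = 0) \<and> (?E 1 3 \<or> b = 0) \<and> (?E 1 2 \<or> c = 0) \<and>
      x = c - b \<and> y = a - c \<and> z = b - a)" for x y z
    by (auto simp: Bs_def kos2_def bd2_def kcomp_def image_iff Bex_def)
  have B0: "(x, y, z) \<in> Bs \<longleftrightarrow> x = 0 \<and> y = 0 \<and> z = 0"
    if "\<not> ?E 1 2" "\<not> ?E 1 3" "\<not> ?E 2 3" for x y z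
    unfolding B using that by auto
  have B12: "(x, y, z) \<in> Bs \<longleftrightarrow> z = 0 \<and> x + y = 0" if "?E 1 2" "\<not> ?E 1 3" "\<not> ?E 2 3" for x y z
    unfolding B using that by (auto simp: add_eq_0_iff)
  have B13: "(x, y, z) \<in> Bs \<longleftrightarrow> y = 0 \<and> x + z = 0" if "\<not> ?E 1 2" "?E 1 3" "\<not> ?E 2 3" for x y z
    unfolding B using that by (auto simp: add_eq_0_iff2)
  have B23: "(x, y, z) \<in> Bs \<longleftrightarrow> x = 0 \<and> y + z = 0" if "\<not> ?E 1 2" "\<not> ?E 1 3" "?E 2 3" for x y z
    unfolding B using that by (auto simp: add_eq_0_iff)
  \<comment> \<open>Two edges already connect all three vertices.\<close>
  have B_all: "(x, y, z) \<in> Bs" if "x + y + z = 0"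
    "?E 1 2 \<and> ?E 1 3 \<or> ?E 1 2 \<and> ?E 2 3 \<or> ?E 1 3 \<and> ?E 2 3" for x y z
  proof -
    note edges = that(2)
    have x: "x = - y - z" using that(1) by (simp add: add_eq_0_iff2 algebra_simps)
    \<comment> \<open>The edge not listed gets coefficient 0; the other two coefficients are then
      determined by \<open>y\<close> and \<open>z\<close>.\<close>
    consider "?E 1 2" "?E 1 3" | "?E 1 2" "?E 2 3" | "?E 1 3" "?E 2 3" using edges by blast
    then show ?thesis
    proof cases
      case 1
      then show ?thesis unfolding B x by - (rule exI[of _ 0], rule exI[of _ z], rule exI[of _ "- y"], simp)
    next
      case 2
      then show ?thesis unfolding B x by - (rule exI[of _ "- z"], rule exI[of _ 0], rule exI[of _ "- y - z"], simp)
    next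
      case 3
      then show ?thesis unfolding B x by - (rule exI[of _ y], rule exI[of _ "y + z"], rule exI[of _ 0], simp)
    qed
  qed
  have "has_qdim (sc3 (*)) Zs Bs
     (if s \<in> exc30 S e then 2 else if s \<in> exc31 S e \<or> s \<in> exc20 S e then 1 else 0)"
  proof (cases "s \<in> exc30 S e")
    case True
    then have E: "\<not> ?E 1 2" "\<not> ?E 1 3" "\<not> ?E 2 3" "?V 1" "?V 2" "?V 3" by (simp_all add: exc30_iff)
    have "has_qdim (sc3 (*)) Zs Bs 2"
    \<comment> \<open>The differences of vertices 1 and 2 with vertex 3 form a basis of the vectors
      of sum zero.\<close>
    proof (rule has_qdim_2[of "(1, 0, - 1)" _ "(0, 1, - 1)"])
      fix v assume v: "v \<in> Zs"
      then obtain x y z where xyz: "v = (x, y, z)" by (cases v)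
      then have "x + y + z = 0" using v Z[of x y z] by blast
      then have "z = - (x + y)" by (rule minus_unique[symmetric])
      then show "\<exists>x y. v - (sc3 (*) x (1, 0, - 1) + sc3 (*) y (0, 1, - 1)) \<in> Bs"
        unfolding xyz
        by - (rule exI[of _ x], rule exI[of _ y], simp add: sc3_def zero_prod_def B0[OF E(1-3)])
    qed (use E in \<open>auto simp: sc3_def Z B0[OF E(1-3)]\<close>)
    then show ?thesis using True by simp
  next
    case not30: False
    show ?thesis
    proof (cases "s \<in> exc31 S e \<or> s \<in> exc20 S e")
      case True
      have one: "has_qdim (sc3 (*)) Zs Bs 1" if b: "(p, q, r) \<in> Zs"
        and span: "\<And>x y z. (x, y, z) \<in> Zs \<Longrightarrow> \<exists>t. (x - t * p, y - t * q, z - t * r) \<in> Bs"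
        and indep: "\<And>t. (t * p, t * q, t * r) \<in> Bs \<Longrightarrow> t = 0" for p q r
        by (rule has_qdim_1[OF b]) (use span indep in \<open>auto simp: sc3_def\<close>)
      \<comment> \<open>The six complexes with two components: an edge with an isolated point, or
        two points. In each case the chosen cycle is a difference of vertices from the two
        components, and its coefficient \<open>t\<close> is read, up to sign, at a vertex forming a
        component alone.\<close>
      consider (12) "?E 1 2" "\<not> ?E 1 3" "\<not> ?E 2 3" "?V 1" "?V 2" "?V 3"
        | (13) "\<not> ?E 1 2" "?E 1 3" "\<not> ?E 2 3" "?V 1" "?V 2" "?V 3"
        | (23) "\<not> ?E 1 2" "\<not> ?E 1 3" "?E 2 3" "?V 1" "?V 2" "?V 3"
        | (no3) "\<not> ?E 1 2" "\<not> ?E 1 3" "\<not> ?E 2 3" "?V 1" "?V 2" "\<not> ?V 3"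
        | (no2) "\<not> ?E 1 2" "\<not> ?E 1 3" "\<not> ?E 2 3" "?V 1" "\<not> ?V 2" "?V 3"
        | (no1) "\<not> ?E 1 2" "\<not> ?E 1 3" "\<not> ?E 2 3" "\<not> ?V 1" "?V 2" "?V 3"
        using True V' unfolding exc31_iff exc20_iff forall_3 by argo
      then have "has_qdim (sc3 (*)) Zs Bs 1"
      proof cases
        case 12
        show ?thesis
        proof (rule one[of 1 0 "- 1"])
          show "\<exists>t. (x - t * 1, y - t * 0, z - t * - 1) \<in> Bs" if "(x, y, z) \<in> Zs" for x y z
            using that by (intro exI[of _ "- z"]) (auto simp: Z B12[OF 12(1-3)] ac_simps)
        qed (use 12 in \<open>auto simp: Z B12[OF 12(1-3)]\<close>)
      next
        case 13
        show ?thesis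
        proof (rule one[of 1 "- 1" 0])
          show "\<exists>t. (x - t * 1, y - t * - 1, z - t * 0) \<in> Bs" if "(x, y, z) \<in> Zs" for x y z
            using that by (intro exI[of _ "- y"]) (auto simp: Z B13[OF 13(1-3)] ac_simps)
        qed (use 13 in \<open>auto simp: Z B13[OF 13(1-3)]\<close>)
      next
        case 23
        show ?thesis
        proof (rule one[of 1 "- 1" 0])
          show "\<exists>t. (x - t * 1, y - t * - 1, z - t * 0) \<in> Bs" if "(x, y, z) \<in> Zs" for x y z
            using that by (intro exI[of _ x]) (auto simp: Z B23[OF 23(1-3)] ac_simps)
        qed (use 23 in \<open>auto simp: Z B23[OF 23(1-3)]\<close>)
      next
        case no3
        show ?thesis
        proof (rule one[of 1 "- 1" 0])
          show "\<exists>t. (x - t * 1, y - t * - 1, z - t * 0) \<in> Bs" if "(x, y, z) \<in> Zs" for x y z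
            using that no3 by (intro exI[of _ x]) (auto simp: Z B0[OF no3(1-3)] ac_simps)
        qed (use no3 in \<open>auto simp: Z B0[OF no3(1-3)]\<close>)
      next
        case no2
        show ?thesis
        proof (rule one[of 1 0 "- 1"])
          show "\<exists>t. (x - t * 1, y - t * 0, z - t * - 1) \<in> Bs" if "(x, y, z) \<in> Zs" for x y z
            using that no2 by (intro exI[of _ x]) (auto simp: Z B0[OF no2(1-3)] ac_simps)
        qed (use no2 in \<open>auto simp: Z B0[OF no2(1-3)]\<close>)
      next
        case no1
        show ?thesis
        proof (rule one[of 0 1 "- 1"])
          show "\<exists>t. (x - t * 0, y - t * 1, z - t * - 1) \<in> Bs" if "(x, y, z) \<in> Zs" for x y z
            using that no1 by (intro exI[of _ y]) (auto simp: Z B0[OF no1(1-3)] ac_simps)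
        qed (use no1 in \<open>auto simp: Z B0[OF no1(1-3)]\<close>)
      qed
      then show ?thesis using True not30 by simp
    next
      case False
      have "v \<in> Bs" if v: "v \<in> Zs" for v
      proof -
        \<comment> \<open>What remains is connected or has no vertex: two or more edges, one edge
          without the third vertex, or at most one vertex.\<close>
        obtain x y z where xyz: "v = (x, y, z)" by (cases v)
        consider "?E 1 2 \<and> ?E 1 3 \<or> ?E 1 2 \<and> ?E 2 3 \<or> ?E 1 3 \<and> ?E 2 3"
          | (12) "?E 1 2" "\<not> ?E 1 3" "\<not> ?E 2 3" | (13) "\<not> ?E 1 2" "?E 1 3" "\<not> ?E 2 3"
          | (23) "\<not> ?E 1 2" "\<not> ?E 1 3" "?E 2 3" | (0) "\<not> ?E 1 2" "\<not> ?E 1 3" "\<not> ?E 2 3"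
          by blast
        then show ?thesis
        proof cases
          case 1
          then show ?thesis using v B_all by (simp add: xyz Z)
        next
          case 12
          then have "\<not> ?V 3" using V False by (auto simp: exc31_iff forall_3)
          then show ?thesis using v by (auto simp: xyz Z B12[OF 12])
        next
          case 13
          then have "\<not> ?V 2" using V False by (auto simp: exc31_iff forall_3)
          then show ?thesis using v by (auto simp: xyz Z B13[OF 13])
        next
          case 23
          then have "\<not> ?V 1" using V False by (auto simp: exc31_iff forall_3)
          then show ?thesis using v by (auto simp: xyz Z B23[OF 23])
        next
          case 0
          then show ?thesis using v not30 False
            by (auto simp: xyz Z B0[OF 0] exc30_iff exc20_iff)
        qed
      qed
      then show ?thesis using False not30 by (auto intro!: has_qdim_0)
    qed
  qed
  then show ?thesis by (simp only: Zs_def Bs_def)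
qed

end

text \<open>Each multiplicity and each value on the right is a dimension of the same Koszul homology
  space, and dimensions are unique.\<close>

lemma shifts_of_minimal_resolution:
  fixes d :: "nat \<Rightarrow> (nat \<Rightarrow>\<^sub>0 'k::field poly3) \<Rightarrow> (nat \<Rightarrow>\<^sub>0 'k poly3)"
  assumes S: "\<forall>s\<in>S. \<forall>i. s + e i \<in> S"
    and res: "minimal_graded_free_resolution S e p F d aug"
  shows "count (mset (F 0)) s = (if s \<in> apery S e then 1 else 0)"
    and "count (mset (F 1)) s =
      (if s \<in> exc30 S e then 2 else if s \<in> exc31 S e \<or> s \<in> exc20 S e then 1 else 0)"
    and "count (mset (F 2)) s = (if s \<in> exc33 S e then 1 else 0)"
proof -
  interpret ray_closed S e by unfold_locales (use S in blast)
  interpret koszul_module "(*) :: 'k \<Rightarrow> _" e "\<lambda>_ x. x" "kcomp S" by (rule koszul_module_kcomp[OF S])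
  note dims = minimal_resolution_has_qdim[OF S res, of s]
  note vs3 = vector_space_sc3[OF vector_space_mult]
  show "count (mset (F 0)) s = (if s \<in> apery S e then 1 else 0)"
    by (rule vector_space.has_qdim_unique[OF vector_space_mult
          subspace_image[OF vector_space_mult lin_on_bd1] dims(1) has_qdim_kcomp_H0])
  show "count (mset (F 1)) s =
      (if s \<in> exc30 S e then 2 else if s \<in> exc31 S e \<or> s \<in> exc20 S e then 1 else 0)"
    by (rule vector_space.has_qdim_unique[OF vs3 subspace_image[OF vs3 lin_on_bd2] dims(2)
          has_qdim_kcomp_H1])
  show "count (mset (F 2)) s = (if s \<in> exc33 S e then 1 else 0)"
    by (rule vector_space.has_qdim_unique[OF vs3 subspace_image[OF vs3 lin_on_bd3] dims(3)
          has_qdim_kcomp_H2])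
qed

lemma affine_monoid_add_gen:
  assumes "s \<in> affine_monoid n a" "k \<in> {1..n}"
  shows "s + a k \<in> affine_monoid n a"
proof -
  obtain l where s: "s = (\<Sum>i = 1..n. int (l i) *s a i)"
    using assms by (auto simp: affine_monoid_def)
  have "(\<Sum>i = 1..n. int ((l(k := Suc (l k))) i) *s a i) =
      (\<Sum>i = 1..n. int (l i) *s a i + (if i = k then a k else 0))"
    by (rule sum.cong) (auto simp: vec_eq_iff algebra_simps)
  also have "\<dots> = s + a k" using assms(2) by (simp add: s sum.distrib)
  finally show ?thesis
    unfolding affine_monoid_def by (intro CollectI exI[of _ "l(k := Suc (l k))"]) simp
qed

theorem theorem2p4:
  fixes n :: nat
    and a :: "nat \<Rightarrow> int ^ 3"
    and \<omega> :: "nat \<Rightarrow> nat"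
    and S :: "(int ^ 3) set"
    and e :: "3 \<Rightarrow> int ^ 3"
    and p :: nat
    and F :: "nat \<Rightarrow> (int ^ 3) list"
    and d :: "nat \<Rightarrow> (nat \<Rightarrow>\<^sub>0 'k::field poly3) \<Rightarrow> (nat \<Rightarrow>\<^sub>0 'k poly3)"
    and aug :: "(nat \<Rightarrow>\<^sub>0 'k poly3) \<Rightarrow> 'k laurent3"
  assumes "n \<ge> 3"
    and "\<And>i. i \<in> {1..n} \<Longrightarrow> a i \<noteq> 0"
    and "\<And>i j. i \<in> {1..n} \<Longrightarrow> 0 \<le> a i $ j"
    and "\<omega> (n - 2) > 0" and "\<omega> (n - 1) > 0" and "\<omega> n > 0"
    and "a (n - 2) = int (\<omega> (n - 2)) *s axis 1 1"
    and "a (n - 1) = int (\<omega> (n - 1)) *s axis 2 1"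
    and "a n = int (\<omega> n) *s axis 3 1"
    and "S = affine_monoid n a"
    and "e = ray_gen n a"
    and "minimal_graded_free_resolution S e p F d aug"
  shows "finite (apery S e) \<and> finite (exc31 S e) \<and> finite (exc20 S e) \<and>
           finite (exc30 S e) \<and> finite (exc33 S e) \<and>
         mset (F 0) = mset_set (apery S e) \<and>
         mset (F 1) = mset_set (exc31 S e) + mset_set (exc20 S e)
                      + mset_set (exc30 S e) + mset_set (exc30 S e) \<and>
         mset (F 2) = mset_set (exc33 S e)"
proof -
  have S: "\<forall>s\<in>S. \<forall>i. s + e i \<in> S"
  proof (intro ballI allI)
    fix s i assume "s \<in> S"
    moreover have "e i \<in> a ` {n - 2, n - 1, n}" unfolding assms(11) ray_gen_def by simp
    then obtain k where "k \<in> {n - 2, n - 1, n}" "e i = a k" by blast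
    ultimately show "s + e i \<in> S"
      using assms(1) affine_monoid_add_gen[of s n a k] unfolding assms(10) by auto
  qed
  interpret ray_closed S e by unfold_locales (use S in blast)
  note counts = shifts_of_minimal_resolution[OF S assms(12)]
  have mem: "s \<in> set xs" if "count (mset xs) s \<noteq> 0" for s and xs :: "(int ^ 3) list"
    using that by (metis count_eq_zero_iff set_mset_mset)
  \<comment> \<open>Finiteness must come before the comparison of multisets, since
    \<open>mset_set\<close> of an infinite set is empty.\<close>
  have "apery S e \<subseteq> set (F 0)" "exc33 S e \<subseteq> set (F 2)"
    by (rule subsetI, rule mem, unfold counts, simp)+
  moreover have "exc31 S e \<union> exc20 S e \<union> exc30 S e \<subseteq> set (F 1)"
    by (rule subsetI, rule mem, unfold counts) auto
  ultimately have fin: "finite (apery S e)" "finite (exc33 S e)"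
      "finite (exc31 S e)" "finite (exc20 S e)" "finite (exc30 S e)"
    using finite_subset[OF _ List.finite_set] unfolding Un_subset_iff by blast+
  \<comment> \<open>Disjointness turns the nested \<open>if\<close> of the counts into the sum of
    the four multisets.\<close>
  have disjoint: "s \<notin> exc31 S e" "s \<notin> exc20 S e" if "s \<in> exc30 S e" for s
    using that by (auto simp: exc30_iff exc31_iff exc20_iff)
  have disjoint': "s \<notin> exc20 S e" if "s \<in> exc31 S e" for s
    using that by (auto simp: exc31_iff exc20_iff)
  have "mset (F 0) = mset_set (apery S e)" "mset (F 2) = mset_set (exc33 S e)"
    by (rule multiset_eqI, unfold counts, simp add: count_mset_set' fin)+
  moreover have "mset (F 1) = mset_set (exc31 S e) + mset_set (exc20 S e)
                      + mset_set (exc30 S e) + mset_set (exc30 S e)"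
    by (rule multiset_eqI, unfold counts) (auto simp: count_mset_set' fin disjoint disjoint')
  ultimately show ?thesis using fin by blast
qed

end
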